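(* In the setting described in the context, for each $1\le r\le N$ the operators $c_r=Q[r]^{N}_{\ N}$ and $\bar c_r=\bar Q[r]_{N}^{\ N}$ commute with $gl(m|n)$ and act on the irreducible $gl(m|n)$-submodule $V(\Lambda)\subseteq V(\tilde\Lambda)$ as the scalars $$c_s=\prod_{k\in\tilde I,\,k\neq s}(\beta_s-\beta_k)^{-1}\prod_{r\in I}\big(\beta_s-\alpha_r-(-1)^{(r)}\big)\quad (s\in\tilde I),\qquad c_i=0\quad (i\in\bar I_0),$$ $$\bar c_s=\prod_{k\in\tilde I',\,k\neq s}(\bar\beta_s-\bar\beta_k)^{-1}\prod_{r\in I'}\big(\bar\beta_s-\bar\alpha_r-(-1)^{(r)}\big)\quad (s\in\tilde I'),\qquad \bar c_i=0\quad (i\in I_0).$$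
   Context: Work over $\mathbb{C}$; $m,n\ge1$, $N=m+n+1$; parity $(p)=0$ for $1\le p\le m$, $(p)=1$ for $m<p\le N$. $gl(m|n+1)$ has homogeneous basis $E_{pq}$ ($1\le p,q\le N$) of parity $(p)+(q)$ with graded bracket $[E_{pq},E_{rs}]=\delta_{qr}E_{ps}-(-1)^{((p)+(q))((r)+(s))}\delta_{ps}E_{rq}$; $gl(m|n)$ is spanned by the $E_{pq}$ with $p,q\le m+n$. Let $V(\tilde\Lambda)$ be a finite-dimensional irreducible $gl(m|n+1)$-module with highest weight having components $\tilde\Lambda_1,\dots,\tilde\Lambda_N$ (eigenvalues of $E_{11},\dots,E_{NN}$ on the highest weight vector), and let $V(\Lambda)\subseteq V(\tilde\Lambda)$ be an irreducible $gl(m|n)$-submodule with highest weight components $\Lambda_1,\dots,\Lambda_{m+n}$. Characteristic roots: for $1\le i\le m$, $\alpha_i=\Lambda_i+m-n-i$, $\bar\alpha_i=i-1-\Lambda_i$, $\beta_i=\tilde\Lambda_i+m-n-1-i$, $\bar\beta_i=i-1-\tilde\Lambda_i$; for $r=m+\mu$ with $1\le\mu\le n$, $\alpha_r=\mu-\Lambda_r-n$, $\bar\alpha_r=\Lambda_r+m+1-\mu$; for $r=m+\mu$ with $1\le\mu\le n+1$, $\beta_r=\mu-\tilde\Lambda_r-n-1$, $\bar\beta_r=\tilde\Lambda_r+m+1-\mu$. Matrices with operator entries: $\mathcal B^p_{\ q}=(-1)^{(p)}E_{pq}$, $\bar{\mathcal B}_p^{\ q}=-(-1)^{(p)(q)}E_{qp}$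 ($1\le p,q\le N$); powers are defined by $(X^k)^p_{\ q}=\sum_r X^p_{\ r}(X^{k-1})^r_{\ q}$, $X^0$ the identity, and polynomials accordingly. Projections $Q[r]=\prod_{k\ne r,1\le k\le N}\frac{\mathcal B-\beta_k}{\beta_r-\beta_k}$ and $\bar Q[r]=\prod_{k\neq r,1\le k\le N}\frac{\bar{\mathcal B}-\bar\beta_k}{\bar\beta_r-\bar\beta_k}$ (operators on $V(\tilde\Lambda)$). Index sets: $I_0=\{1\le i\le m:\alpha_i=\beta_i\}$, $\bar I_0=\{1\le i\le m:\alpha_i=\beta_i+1\}$, $I_1=\{m+1,\dots,m+n\}$, $I=I_0\cup I_1$, $\tilde I=I\cup\{N\}$, $I'=\bar I_0\cup I_1$, $\tilde I'=I'\cup\{N\}$. Standing genericity assumption: the roots $\beta_1,\dots,\beta_N$ are pairwise distinct, as are $\bar\beta_1,\dots,\bar\beta_N$, $\alpha_1,\dots,\alpha_{m+n}$ and $\bar\alpha_1,\dots,\bar\alpha_{m+n}$. *)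

theory Defs
  imports "HOL-Analysis.Analysis" "HOL-Computational_Algebra.Polynomial"
begin

text \<open>Modules are realised concretely on the finite-dimensional complex vector space
  complex^'d (every finite-dimensional complex vector space is isomorphic to one of these);
  operators are complex matrices complex^'d^'d acting by *v.  The representation is
  rho p q = action of E_pq, for indices 1..N.\<close>

definition par :: "nat \<Rightarrow> nat \<Rightarrow> nat" where
  "par m p = (if p \<le> m then 0 else 1)"

definition psign :: "nat \<Rightarrow> complex" where
  "psign k = (-1) ^ k"

definition csubspace :: "(complex^'d) set \<Rightarrow> bool" where
  "csubspace W \<longleftrightarrow> 0 \<in> W \<and> (\<forall>x\<in>W. \<forall>y\<in>W. x + y \<in> W) \<and> (\<forall>c::complex. \<forall>x\<in>W. c *s x \<in> W)"

text \<open>rho is a representation of gl(m|K-m) (indices 1..K) with parity operator P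
  (a Z2-grading of complex^'d: P^2 = 1, and E_pq has parity (p)+(q)).\<close>
definition is_gl_super_rep ::
  "nat \<Rightarrow> nat \<Rightarrow> (nat \<Rightarrow> nat \<Rightarrow> complex^'d^'d) \<Rightarrow> complex^'d^'d \<Rightarrow> bool" where
  "is_gl_super_rep m K rho P \<longleftrightarrow>
     P ** P = mat 1 \<and>
     (\<forall>p\<in>{1..K}. \<forall>q\<in>{1..K}.
        rho p q ** P = mat (psign (par m p + par m q)) ** (P ** rho p q)) \<and>
     (\<forall>p\<in>{1..K}. \<forall>q\<in>{1..K}. \<forall>r\<in>{1..K}. \<forall>s\<in>{1..K}.
        rho p q ** rho r s
          - mat (psign ((par m p + par m q) * (par m r + par m s))) ** (rho r s ** rho p q)
        = (if q = r then rho p s else 0)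
          - mat (psign ((par m p + par m q) * (par m r + par m s))) ** (if p = s then rho r q else 0))"

definition graded_invariant ::
  "nat \<Rightarrow> (nat \<Rightarrow> nat \<Rightarrow> complex^'d^'d) \<Rightarrow> complex^'d^'d \<Rightarrow> (complex^'d) set \<Rightarrow> bool" where
  "graded_invariant K rho P W \<longleftrightarrow> csubspace W \<and> (\<forall>w\<in>W. P *v w \<in> W) \<and>
     (\<forall>p\<in>{1..K}. \<forall>q\<in>{1..K}. \<forall>w\<in>W. rho p q *v w \<in> W)"

definition irred_hw_module ::
  "nat \<Rightarrow> (nat \<Rightarrow> nat \<Rightarrow> complex^'d^'d) \<Rightarrow> complex^'d^'d \<Rightarrow> (complex^'d) set
     \<Rightarrow> (nat \<Rightarrow> complex) \<Rightarrow> bool" where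
  "irred_hw_module K rho P W Lam \<longleftrightarrow>
     graded_invariant K rho P W \<and>
     (\<forall>U. U \<subseteq> W \<longrightarrow> graded_invariant K rho P U \<longrightarrow> U = {0} \<or> U = W) \<and>
     (\<exists>v0\<in>W. v0 \<noteq> 0 \<and> (P *v v0 = v0 \<or> P *v v0 = - v0) \<and>
        (\<forall>p\<in>{1..K}. rho p p *v v0 = Lam p *s v0) \<and>
        (\<forall>p\<in>{1..K}. \<forall>q\<in>{1..K}. p < q \<longrightarrow> rho p q *v v0 = 0))"

definition alpha :: "nat \<Rightarrow> nat \<Rightarrow> (nat \<Rightarrow> complex) \<Rightarrow> nat \<Rightarrow> complex" where
  "alpha m n Lam i = (if i \<le> m then Lam i + of_nat m - of_nat n - of_nat i
                      else of_nat (i - m) - Lam i - of_nat n)"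

definition alphabar :: "nat \<Rightarrow> nat \<Rightarrow> (nat \<Rightarrow> complex) \<Rightarrow> nat \<Rightarrow> complex" where
  "alphabar m n Lam i = (if i \<le> m then of_nat i - 1 - Lam i
                         else Lam i + of_nat m + 1 - of_nat (i - m))"

definition beta :: "nat \<Rightarrow> nat \<Rightarrow> (nat \<Rightarrow> complex) \<Rightarrow> nat \<Rightarrow> complex" where
  "beta m n LamT i = (if i \<le> m then LamT i + of_nat m - of_nat n - 1 - of_nat i
                      else of_nat (i - m) - LamT i - of_nat n - 1)"

definition betabar :: "nat \<Rightarrow> nat \<Rightarrow> (nat \<Rightarrow> complex) \<Rightarrow> nat \<Rightarrow> complex" where
  "betabar m n LamT i = (if i \<le> m then of_nat i - 1 - LamT i
                         else LamT i + of_nat m + 1 - of_nat (i - m))"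

definition opmat_mult :: "nat \<Rightarrow> (nat \<Rightarrow> nat \<Rightarrow> complex^'d^'d) \<Rightarrow> (nat \<Rightarrow> nat \<Rightarrow> complex^'d^'d)
    \<Rightarrow> nat \<Rightarrow> nat \<Rightarrow> complex^'d^'d" where
  "opmat_mult N X Y = (\<lambda>p q. \<Sum>r\<in>{1..N}. X p r ** Y r q)"

fun opmat_pow :: "nat \<Rightarrow> (nat \<Rightarrow> nat \<Rightarrow> complex^'d^'d) \<Rightarrow> nat \<Rightarrow> nat \<Rightarrow> nat \<Rightarrow> complex^'d^'d" where
  "opmat_pow N X 0 = (\<lambda>p q. if p = q then mat 1 else 0)"
| "opmat_pow N X (Suc k) = opmat_mult N X (opmat_pow N X k)"

definition opmat_poly :: "nat \<Rightarrow> complex poly \<Rightarrow> (nat \<Rightarrow> nat \<Rightarrow> complex^'d^'d)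
    \<Rightarrow> nat \<Rightarrow> nat \<Rightarrow> complex^'d^'d" where
  "opmat_poly N f X = (\<lambda>p q. \<Sum>k\<le>degree f. mat (coeff f k) ** opmat_pow N X k p q)"

definition proj_poly :: "nat \<Rightarrow> (nat \<Rightarrow> complex) \<Rightarrow> nat \<Rightarrow> complex poly" where
  "proj_poly N b r = (\<Prod>k\<in>{1..N} - {r}. smult (1 / (b r - b k)) [:- b k, 1:])"

definition Bmat :: "nat \<Rightarrow> (nat \<Rightarrow> nat \<Rightarrow> complex^'d^'d) \<Rightarrow> nat \<Rightarrow> nat \<Rightarrow> complex^'d^'d" where
  "Bmat m rho = (\<lambda>p q. mat (psign (par m p)) ** rho p q)"

definition Bbarmat :: "nat \<Rightarrow> (nat \<Rightarrow> nat \<Rightarrow> complex^'d^'d) \<Rightarrow> nat \<Rightarrow> nat \<Rightarrow> complex^'d^'d" where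
  "Bbarmat m rho = (\<lambda>p q. - (mat (psign (par m p * par m q)) ** rho q p))"

definition Qproj :: "nat \<Rightarrow> nat \<Rightarrow> (nat \<Rightarrow> complex) \<Rightarrow> (nat \<Rightarrow> nat \<Rightarrow> complex^'d^'d) \<Rightarrow> nat
    \<Rightarrow> nat \<Rightarrow> nat \<Rightarrow> complex^'d^'d" where
  "Qproj m n LamT rho r = opmat_poly (m+n+1) (proj_poly (m+n+1) (beta m n LamT) r) (Bmat m rho)"

definition Qbarproj :: "nat \<Rightarrow> nat \<Rightarrow> (nat \<Rightarrow> complex) \<Rightarrow> (nat \<Rightarrow> nat \<Rightarrow> complex^'d^'d) \<Rightarrow> nat
    \<Rightarrow> nat \<Rightarrow> nat \<Rightarrow> complex^'d^'d" where
  "Qbarproj m n LamT rho r = opmat_poly (m+n+1) (proj_poly (m+n+1) (betabar m n LamT) r) (Bbarmat m rho)"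

definition I0 where "I0 m n Lam LamT = {i\<in>{1..m}. alpha m n Lam i = beta m n LamT i}"
definition I0bar where "I0bar m n Lam LamT = {i\<in>{1..m}. alpha m n Lam i = beta m n LamT i + 1}"
definition I1 :: "nat \<Rightarrow> nat \<Rightarrow> nat set" where "I1 m n = {m+1..m+n}"
definition Iset where "Iset m n Lam LamT = I0 m n Lam LamT \<union> I1 m n"
definition Itil where "Itil m n Lam LamT = Iset m n Lam LamT \<union> {m+n+1}"
definition Iprime where "Iprime m n Lam LamT = I0bar m n Lam LamT \<union> I1 m n"
definition Itilprime where "Itilprime m n Lam LamT = Iprime m n Lam LamT \<union> {m+n+1}"

end

theory Submission
  imports Defs
begin

text \<open>
  Let \<open>R(u) = (u - B)\<^sup>-\<^sup>1\<close> for large real \<open>u\<close>, \<open>c(u) = R(u)\<^sub>N\<^sub>N\<close>, let \<open>\<tau>(u)\<close> be the supertrace of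
  \<open>R(u)\<close>, and \<open>\<tau>'(u)\<close> the analogue for \<open>gl(m|n)\<close>. The commutation relations give
  \<open>(1 - \<tau>(u)) c(u + 1) = c(u) (1 - \<tau>'(u + 1))\<close>. Both supertraces are central and a triangular
  computation on a highest weight vector shows that \<open>1 - \<tau>\<close> acts as the product of
  \<open>(u - \<beta>\<^sub>r - (-1)\<^sup>(\<^sup>r\<^sup>)) / (u - \<beta>\<^sub>r)\<close>, and \<open>1 - \<tau>'\<close> likewise with \<open>\<alpha>\<^sub>r\<close>. Since \<open>u c(u) \<rightarrow> 1\<close>, the
  difference equation determines \<open>c(u)\<close> on a highest weight vector \<open>w\<close> of \<open>V(\<Lambda>)\<close>: its eigenvalue is
  \<open>\<Prod>\<^sub>i\<^sub>\<le>\<^sub>m (u - \<beta>\<^sub>i - 1) / (u - \<alpha>\<^sub>i) \<cdot> \<Prod>\<^sub>\<mu> (u - \<alpha>\<^sub>\<mu> + 1) / \<Prod>\<^sub>\<mu> (u - \<beta>\<^sub>\<mu>)\<close>.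
  Applying a longest non-annihilating product of the \<open>E\<^sub>p\<^sub>N\<close> to \<open>w\<close> produces a highest weight vector
  of \<open>V\<close>, and the odd \<open>E\<^sub>i\<^sub>N\<close> square to zero; hence \<open>\<alpha>\<^sub>i\<close> is \<open>\<beta>\<^sub>i\<close> or \<open>\<beta>\<^sub>i + 1\<close>, the surplus factors
  cancel, and the residues at the \<open>\<beta>\<^sub>s\<close> are the asserted scalars. The barred case is the same
  argument for the representation twisted by minus the supertranspose.
\<close>

section \<open>Operators as a Banach algebra\<close>

text \<open>Taking u to be a large real number instead of a formal variable makes the shift to u + 1
  a plain substitution. The price is a convergence bound for every series and a norm on operators.
  No characteristic identity for B is proved. Comparing the expansion of c(u) w at infinity with
  partial fractions shows that the corner of B^k acts on w as the sum of c_s \<beta>_s^k. Hence the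
  corner of f(B) acts as the sum of c_s f(\<beta>_s) for every polynomial f, and the interpolation
  polynomial behind Q[s] returns c_s, or 0 if \<beta>_s is no pole. The shift by 1 comes from a
  single bracket: moving E_bN past the corner of the resolvent reproduces the column entry at b,
  with a sign fixed by N being odd. Complete reducibility, which may fail for superalgebras, is
  avoided: scalars are computed on one singular vector and spread by irreducibility, and weights are
  compared through words in the generators.\<close>

text \<open>A copy of the type of bounded operators, made so that composition is the multiplication of a
  Banach algebra type; the product \<open>(*)\<close> on \<open>complex^'d^'d\<close> itself is componentwise.\<close>

typedef (overloaded) 'v endo = "UNIV :: ('v::{banach,perfect_space} \<Rightarrow>\<^sub>L 'v) set"
  morphisms blinfun_of_endo endo_of_blinfun
  by simp

setup_lifting type_definition_endo

instantiation endo :: ("{banach,perfect_space}") ring_1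
begin

lift_definition zero_endo :: "'a endo" is 0 .
lift_definition one_endo :: "'a endo" is id_blinfun .
lift_definition plus_endo :: "'a endo \<Rightarrow> 'a endo \<Rightarrow> 'a endo" is "(+)" .
lift_definition minus_endo :: "'a endo \<Rightarrow> 'a endo \<Rightarrow> 'a endo" is "(-)" .
lift_definition uminus_endo :: "'a endo \<Rightarrow> 'a endo" is uminus .
lift_definition times_endo :: "'a endo \<Rightarrow> 'a endo \<Rightarrow> 'a endo" is "(o\<^sub>L)" .

instance
proof
  \<comment> \<open>The sort \<open>perfect_space\<close> enters here: it excludes the zero space,
    on which 0 = 1.\<close>
  show "(0 :: 'a endo) \<noteq> 1"
    by transfer (metis norm_blinfun_id norm_zero zero_neq_one)
qed (transfer; rule blinfun_eqI; simp add: blinfun.bilinear_simps)+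

end

instantiation endo :: ("{banach,perfect_space}") real_algebra_1
begin

lift_definition scaleR_endo :: "real \<Rightarrow> 'a endo \<Rightarrow> 'a endo" is "(*\<^sub>R)" .

instance
  by standard (transfer; rule blinfun_eqI; simp add: blinfun.bilinear_simps algebra_simps)+

end

instantiation endo :: ("{banach,perfect_space}") real_normed_algebra_1
begin

lift_definition norm_endo :: "'a endo \<Rightarrow> real" is norm .
lift_definition dist_endo :: "'a endo \<Rightarrow> 'a endo \<Rightarrow> real" is dist .
definition uniformity_endo :: "('a endo \<times> 'a endo) filter" where
  "uniformity_endo = (INF e\<in>{0<..}. principal {(x, y). dist x y < e})"
definition open_endo :: "'a endo set \<Rightarrow> bool" where
  "open_endo U \<longleftrightarrow> (\<forall>x\<in>U. \<forall>\<^sub>F (x', y) in uniformity. x' = x \<longrightarrow> y \<in> U)"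
definition sgn_endo :: "'a endo \<Rightarrow> 'a endo" where
  "sgn_endo x = inverse (norm x) *\<^sub>R x"

instance
proof
  fix x y :: "'a endo" and a :: real
  show "dist x y = norm (x - y)" by transfer (rule dist_norm)
  show "norm x = 0 \<longleftrightarrow> x = 0" by transfer simp
  show "norm (x + y) \<le> norm x + norm y" by transfer (rule norm_triangle_ineq)
  show "norm (a *\<^sub>R x) = \<bar>a\<bar> * norm x" by transfer simp
  show "norm (x * y) \<le> norm x * norm y" by transfer (rule norm_blinfun_compose)
  show "norm (1 :: 'a endo) = 1" by transfer (rule norm_blinfun_id)
  show "sgn x = x /\<^sub>R norm x" by (simp add: sgn_endo_def)
qed (simp_all add: uniformity_endo_def open_endo_def)

end

instance endo :: ("{banach,perfect_space}") banach
proof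
  fix X :: "nat \<Rightarrow> 'a endo"
  assume "Cauchy X"
  then have "Cauchy (\<lambda>n. blinfun_of_endo (X n))"
    unfolding Cauchy_def by (simp add: dist_endo.rep_eq)
  then obtain L where "(\<lambda>n. blinfun_of_endo (X n)) \<longlonglongrightarrow> L"
    using Cauchy_convergent_iff convergent_def by blast
  then have "X \<longlonglongrightarrow> endo_of_blinfun L"
    unfolding lim_sequentially by (simp add: dist_endo.rep_eq endo_of_blinfun_inverse)
  then show "convergent X" by (auto simp: convergent_def)
qed

lift_definition app :: "'v::{banach,perfect_space} endo \<Rightarrow> 'v \<Rightarrow> 'v" is blinfun_apply .

lemma bounded_bilinear_app: "bounded_bilinear app"
proof
  show "\<exists>K. \<forall>(a::'a endo) b. norm (app a b) \<le> norm a * norm b * K"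
    by (rule exI[of _ 1]) (transfer, simp add: norm_blinfun)
qed (transfer; simp add: blinfun.bilinear_simps)+

interpretation app: bounded_bilinear app by (rule bounded_bilinear_app)

lemma app_mult [simp]: "app (a * b) x = app a (app b x)"
  by transfer simp

lemma app_one [simp]: "app 1 x = x"
  by transfer simp

text \<open>Elements of \<open>endo\<close> are only real-linear. Complex scalars therefore enter as
  the operators \<open>mat_endo (mat c)\<close>, and complex linearity becomes commutation with
  them.\<close>

lift_definition mat_endo :: "complex^'d^'d \<Rightarrow> (complex^'d) endo" is "\<lambda>A. Blinfun ((*v) A)" .

lemma app_mat_endo [simp]: "app (mat_endo A) x = A *v x"
  by transfer (simp add: bounded_linear_Blinfun_apply matrix_vector_mul_bounded_linear)

lemma endo_eqI: "(\<And>x. app a x = app b x) \<Longrightarrow> a = b"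
  by transfer (rule blinfun_eqI)

lemma mat_endo_mult: "mat_endo (A ** B) = mat_endo A * mat_endo B"
  by (rule endo_eqI) (simp add: matrix_vector_mul_assoc)

lemma mat_endo_add: "mat_endo (A + B) = mat_endo A + mat_endo B"
  by (rule endo_eqI) (simp add: app.add_left matrix_vector_mult_add_rdistrib)

lemma mat_endo_zero: "mat_endo 0 = 0"
  by (rule endo_eqI) (simp add: app.zero_left)

lemma mat_endo_one: "mat_endo (mat 1) = 1"
  by (rule endo_eqI) simp

lemma mat_endo_sum: "mat_endo (\<Sum>i\<in>A. f i) = (\<Sum>i\<in>A. mat_endo (f i))"
  by (induction A rule: infinite_finite_induct) (simp_all add: mat_endo_zero mat_endo_add)

lemma mat_endo_inj: "mat_endo A = mat_endo B \<Longrightarrow> A = B"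
  by (metis app_mat_endo matrix_eq)

section \<open>Expansions at infinity and resolvents\<close>

text \<open>For D k = b^k this is 1 / (u - b); in general D is read as a sequence of moments and
  \<open>gseries D\<close> as its resolvent function.\<close>

definition gseries :: "(nat \<Rightarrow> 'b::banach) \<Rightarrow> real \<Rightarrow> 'b" where
  "gseries D u = (\<Sum>k. (1 / u) ^ Suc k *\<^sub>R D k)"

text \<open>The radius \<open>M\<close> is explicit because series that are added or compared must
  share one domain u > M; only \<open>C\<close> may change.\<close>

definition geom_bounded :: "real \<Rightarrow> real \<Rightarrow> (nat \<Rightarrow> 'b::banach) \<Rightarrow> bool" where
  "geom_bounded C M D \<longleftrightarrow> 0 \<le> M \<and> (\<forall>k. norm (D k) \<le> C * M ^ k)"

lemma geom_bounded_majorant: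
  assumes "geom_bounded C M D" "M < u"
  shows "(\<lambda>k. C / u * (M / u) ^ k) sums (C / (u - M))"
    and "norm ((1 / u) ^ Suc k *\<^sub>R D k) \<le> C / u * (M / u) ^ k"
proof -
  have u: "0 \<le> M" "0 < u" using assms by (auto simp: geom_bounded_def)
  have "(\<lambda>k. C / u * (M / u) ^ k) sums (C / u * (1 / (1 - M / u)))"
    by (intro sums_mult geometric_sums) (use u assms in simp)
  also have "C / u * (1 / (1 - M / u)) = C / (u - M)"
    using u assms by (simp add: field_simps)
  finally show "(\<lambda>k. C / u * (M / u) ^ k) sums (C / (u - M))" .
  have "norm ((1 / u) ^ Suc k *\<^sub>R D k) = (1 / u) ^ Suc k * norm (D k)"
    using u by simp
  also have "\<dots> \<le> (1 / u) ^ Suc k * (C * M ^ k)"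
    by (rule mult_left_mono) (use assms u in \<open>auto simp: geom_bounded_def\<close>)
  also have "\<dots> = C / u * (M / u) ^ k" by (simp add: power_divide)
  finally show "norm ((1 / u) ^ Suc k *\<^sub>R D k) \<le> C / u * (M / u) ^ k" .
qed

lemma gseries_summable:
  assumes "geom_bounded C M D" "M < u"
  shows "summable (\<lambda>k. (1 / u) ^ Suc k *\<^sub>R D k)"
  by (rule summable_comparison_test'[OF sums_summable[OF geom_bounded_majorant(1)[OF assms]]])
    (rule geom_bounded_majorant(2)[OF assms])

lemma gseries_bound:
  assumes "geom_bounded C M D" "M < u"
  shows "norm (gseries D u) \<le> C / (u - M)"
proof -
  have s: "summable (\<lambda>k. norm ((1 / u) ^ Suc k *\<^sub>R D k))"
    by (rule summable_comparison_test'[OF sums_summable[OF geom_bounded_majorant(1)[OF assms]]])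
      (use geom_bounded_majorant(2)[OF assms] in simp)
  have "norm (gseries D u) \<le> (\<Sum>k. norm ((1 / u) ^ Suc k *\<^sub>R D k))"
    unfolding gseries_def by (rule summable_norm[OF s])
  also have "\<dots> \<le> (\<Sum>k. C / u * (M / u) ^ k)"
    by (rule suminf_le[OF _ s sums_summable[OF geom_bounded_majorant(1)[OF assms]]])
      (rule geom_bounded_majorant(2)[OF assms])
  also have "\<dots> = C / (u - M)"
    using geom_bounded_majorant(1)[OF assms] by (rule sums_unique[symmetric])
  finally show ?thesis .
qed

lemma geom_bounded_shift:
  assumes "geom_bounded C M D"
  shows "geom_bounded (C * M) M (\<lambda>k. D (Suc k))"
  using assms unfolding geom_bounded_def by (metis mult.assoc power_Suc)

text \<open>Multiplication by u splits off the leading coefficient. The two resolvent equations, the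
  limit at infinity and the uniqueness of coefficients all come from this.\<close>

lemma gseries_shift:
  assumes "geom_bounded C M D" "M < u"
  shows "u *\<^sub>R gseries D u = D 0 + gseries (\<lambda>k. D (Suc k)) u"
proof -
  have u: "0 < u" using assms by (auto simp: geom_bounded_def)
  have "gseries D u = (1 / u) *\<^sub>R D 0 + (\<Sum>k. (1 / u) ^ Suc (Suc k) *\<^sub>R D (Suc k))"
    unfolding gseries_def using suminf_split_head[OF gseries_summable[OF assms]] by simp
  also have "(\<Sum>k. (1 / u) ^ Suc (Suc k) *\<^sub>R D (Suc k)) = (1 / u) *\<^sub>R gseries (\<lambda>k. D (Suc k)) u"
    unfolding gseries_def
    using suminf_scaleR_right[OF gseries_summable[OF geom_bounded_shift[OF assms(1)] assms(2)], of "1/u"]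
    by simp
  finally show ?thesis using u by (simp add: scaleR_right_distrib)
qed

lemma gseries_limit:
  assumes "geom_bounded C M D"
  shows "((\<lambda>u. u *\<^sub>R gseries D u) \<longlongrightarrow> D 0) at_top"
proof -
  have "((\<lambda>u. (C * M) / (u - M)) \<longlongrightarrow> 0) at_top"
    by (intro tendsto_divide_0[OF tendsto_const] filterlim_at_top_imp_at_infinity
        filterlim_tendsto_add_at_top[OF tendsto_const[of "-M"] filterlim_ident, simplified])
  then have "((\<lambda>u. gseries (\<lambda>k. D (Suc k)) u) \<longlongrightarrow> 0) at_top"
  proof (rule Lim_null_comparison[rotated])
    show "\<forall>\<^sub>F u in at_top. norm (gseries (\<lambda>k. D (Suc k)) u) \<le> C * M / (u - M)"
      using eventually_gt_at_top[of M]
      by eventually_elim (rule gseries_bound[OF geom_bounded_shift[OF assms]])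
  qed
  then have "((\<lambda>u. D 0 + gseries (\<lambda>k. D (Suc k)) u) \<longlongrightarrow> D 0 + 0) at_top"
    by (intro tendsto_intros)
  then have "((\<lambda>u. D 0 + gseries (\<lambda>k. D (Suc k)) u) \<longlongrightarrow> D 0) at_top" by simp
  moreover have "\<forall>\<^sub>F u in at_top. D 0 + gseries (\<lambda>k. D (Suc k)) u = u *\<^sub>R gseries D u"
    using eventually_gt_at_top[of M] by eventually_elim (rule gseries_shift[OF assms, symmetric])
  ultimately show ?thesis by (rule Lim_transform_eventually)
qed

text \<open>The limit of u times the series isolates D 0; once D 0 = 0, the shifted sequence again
  has a vanishing series.\<close>

lemma gseries_zero_imp_coeffs_zero:
  assumes "geom_bounded C M D" and "\<forall>\<^sub>F u in at_top. gseries D u = 0"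
  shows "D k = 0"
  using assms
proof (induction k arbitrary: C D)
  case (0 C D)
  have "((\<lambda>u. u *\<^sub>R gseries D u) \<longlongrightarrow> 0) at_top"
    by (rule tendsto_eventually) (use 0(2) in \<open>eventually_elim, simp\<close>)
  then show ?case
    using gseries_limit[OF 0(1)] tendsto_unique[OF trivial_limit_at_top_linorder] by blast
next
  case (Suc k C D)
  have D0: "D 0 = 0"
  proof -
    have "((\<lambda>u. u *\<^sub>R gseries D u) \<longlongrightarrow> 0) at_top"
      by (rule tendsto_eventually) (use Suc(3) in \<open>eventually_elim, simp\<close>)
    then show ?thesis
      using gseries_limit[OF Suc(2)] tendsto_unique[OF trivial_limit_at_top_linorder] by blast
  qed
  have "\<forall>\<^sub>F u in at_top. gseries (\<lambda>k. D (Suc k)) u = 0"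
    using Suc(3) eventually_gt_at_top[of M]
    by eventually_elim (metis gseries_shift[OF Suc(2)] D0 add_0 scaleR_zero_right)
  from Suc.IH[OF geom_bounded_shift[OF Suc(2)] this] show ?case .
qed

lemma gseries_bounded_linear:
  assumes "bounded_linear f" "geom_bounded C M D" "M < u"
  shows "f (gseries D u) = gseries (\<lambda>k. f (D k)) u"
  unfolding gseries_def
  using bounded_linear.suminf[OF assms(1) gseries_summable[OF assms(2,3)]]
  by (simp add: linear_cmul[OF bounded_linear.linear[OF assms(1)]])

lemma geom_bounded_bounded_linear:
  assumes "bounded_linear f" "geom_bounded C M D"
  shows "\<exists>C'. geom_bounded C' M (\<lambda>k. f (D k))"
proof -
  obtain K where K: "K > 0" "\<And>x. norm (f x) \<le> norm x * K"
    using bounded_linear.pos_bounded[OF assms(1)] by auto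
  have "norm (f (D k)) \<le> (C * K) * M ^ k" for k
  proof -
    have "norm (f (D k)) \<le> norm (D k) * K" by (rule K)
    also have "\<dots> \<le> C * M ^ k * K"
      by (rule mult_right_mono) (use assms K in \<open>auto simp: geom_bounded_def\<close>)
    finally show ?thesis by (simp add: mult_ac)
  qed
  then show ?thesis using assms(2) by (auto simp: geom_bounded_def)
qed

lemma geom_bounded_add:
  assumes "geom_bounded C M D" "geom_bounded C' M D'"
  shows "geom_bounded (C + C') M (\<lambda>k. D k + D' k)"
  unfolding geom_bounded_def
proof (intro conjI allI)
  fix k
  have "norm (D k + D' k) \<le> norm (D k) + norm (D' k)" by (rule norm_triangle_ineq)
  also have "\<dots> \<le> C * M ^ k + C' * M ^ k"
    by (intro add_mono) (use assms in \<open>auto simp: geom_bounded_def\<close>)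
  finally show "norm (D k + D' k) \<le> (C + C') * M ^ k" by (simp add: algebra_simps)
qed (use assms in \<open>auto simp: geom_bounded_def\<close>)

lemma gseries_add:
  assumes "geom_bounded C M D" "geom_bounded C' M D'" "M < u"
  shows "gseries (\<lambda>k. D k + D' k) u = gseries D u + gseries D' u"
  unfolding gseries_def
  using suminf_add[OF gseries_summable[OF assms(1,3)] gseries_summable[OF assms(2,3)]]
  by (simp add: scaleR_right_distrib)

lemma gseries_sum:
  assumes "finite A" "\<And>i. i \<in> A \<Longrightarrow> \<exists>C. geom_bounded C M (D i)" "M < u"
  shows "gseries (\<lambda>k. \<Sum>i\<in>A. D i k) u = (\<Sum>i\<in>A. gseries (D i) u)"
proof -
  have "summable (\<lambda>k. (1 / u) ^ Suc k *\<^sub>R D i k)" if "i \<in> A" for i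
    using gseries_summable assms(2)[OF that] assms(3) by blast
  then show ?thesis
    unfolding gseries_def scaleR_right.sum by (rule suminf_sum)
qed

section \<open>Matrix powers with noncommuting entries and their resolvents\<close>

fun mpow :: "nat \<Rightarrow> (nat \<Rightarrow> nat \<Rightarrow> 'a::ring_1) \<Rightarrow> nat \<Rightarrow> nat \<Rightarrow> nat \<Rightarrow> 'a" where
  "mpow N X 0 = (\<lambda>p q. if p = q then 1 else 0)"
| "mpow N X (Suc k) = (\<lambda>p q. \<Sum>r\<in>{1..N}. X p r * mpow N X k r q)"

lemma mpow_Suc_right:
  assumes "p \<in> {1..N}" "q \<in> {1..N}"
  shows "mpow N X (Suc k) p q = (\<Sum>r\<in>{1..N}. mpow N X k p r * X r q)"
  using assms
proof (induction k arbitrary: p)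
  case 0
  then show ?case by (simp add: if_distrib if_distribR cong: if_cong)
next
  case (Suc k)
  have "mpow N X (Suc (Suc k)) p q = (\<Sum>r\<in>{1..N}. X p r * (\<Sum>s\<in>{1..N}. mpow N X k r s * X s q))"
    using Suc by (subst mpow.simps) (intro sum.cong refl, auto)
  also have "\<dots> = (\<Sum>s\<in>{1..N}. mpow N X (Suc k) p s * X s q)"
    by (simp add: sum_distrib_left sum_distrib_right mult.assoc) (rule sum.swap)
  finally show ?case .
qed

text \<open>The factor N pays for the N summands of one matrix product. The bound is crude but
  increases with N, so a u admissible for gl(m|n+1) is admissible for gl(m|n).\<close>

definition rad :: "nat \<Rightarrow> (nat \<Rightarrow> nat \<Rightarrow> 'a::real_normed_vector) \<Rightarrow> real" where
  "rad N X = real N * (\<Sum>p\<in>{1..N}. \<Sum>q\<in>{1..N}. norm (X p q))"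

definition res :: "nat \<Rightarrow> (nat \<Rightarrow> nat \<Rightarrow> 'a::{real_normed_algebra_1,banach}) \<Rightarrow> real
    \<Rightarrow> nat \<Rightarrow> nat \<Rightarrow> 'a" where
  "res N X u p q = gseries (\<lambda>k. mpow N X k p q) u"

lemma rad_nonneg: "0 \<le> rad N X"
  unfolding rad_def by (simp add: sum_nonneg)

lemma rad_mono: "N \<le> N' \<Longrightarrow> rad N X \<le> rad N' X"
  unfolding rad_def
  by (intro mult_mono sum_nonneg order_trans[OF sum_mono sum_mono2] sum_mono2) auto

lemma geom_bounded_mpow:
  fixes X :: "nat \<Rightarrow> nat \<Rightarrow> 'a::{real_normed_algebra_1,banach}"
  assumes "p \<in> {1..N}" "q \<in> {1..N}"
  shows "geom_bounded 1 (rad N X) (\<lambda>k. mpow N X k p q)"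
proof -
  let ?S = "\<Sum>p\<in>{1..N}. \<Sum>q\<in>{1..N}. norm (X p q)"
  have X: "norm (X p q) \<le> ?S" if "p \<in> {1..N}" "q \<in> {1..N}" for p q
  proof -
    have "norm (X p q) \<le> (\<Sum>q\<in>{1..N}. norm (X p q))"
      by (rule member_le_sum) (use that in auto)
    also have "\<dots> \<le> ?S"
      by (rule member_le_sum[of p "{1..N}" "\<lambda>p. \<Sum>q\<in>{1..N}. norm (X p q)"])
        (use that in \<open>auto intro: sum_nonneg\<close>)
    finally show ?thesis .
  qed
  have "norm (mpow N X k p q) \<le> rad N X ^ k" if "p \<in> {1..N}" "q \<in> {1..N}" for k p q
    using that
  proof (induction k arbitrary: p)
    case (Suc k)
    have "norm (mpow N X (Suc k) p q) \<le> (\<Sum>r\<in>{1..N}. norm (X p r * mpow N X k r q))"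
      by (simp add: norm_sum)
    also have "\<dots> \<le> (\<Sum>r\<in>{1..N}. ?S * rad N X ^ k)"
      by (intro sum_mono order_trans[OF norm_mult_ineq] mult_mono X Suc)
        (use Suc in \<open>auto intro!: sum_nonneg\<close>)
    also have "\<dots> = rad N X ^ Suc k" by (simp add: rad_def)
    finally show ?case .
  qed simp
  then show ?thesis using assms by (simp add: geom_bounded_def rad_nonneg)
qed

lemma res_left:
  assumes "rad N X < u" "p \<in> {1..N}" "q \<in> {1..N}"
  shows "u *\<^sub>R res N X u p q = (if p = q then 1 else 0) + (\<Sum>t\<in>{1..N}. X p t * res N X u t q)"
proof -
  have "u *\<^sub>R res N X u p q = (if p = q then 1 else 0)
      + gseries (\<lambda>k. \<Sum>t\<in>{1..N}. X p t * mpow N X k t q) u"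
    unfolding res_def by (subst gseries_shift[OF geom_bounded_mpow]) (use assms in auto)
  also have "gseries (\<lambda>k. \<Sum>t\<in>{1..N}. X p t * mpow N X k t q) u
      = (\<Sum>t\<in>{1..N}. gseries (\<lambda>k. X p t * mpow N X k t q) u)"
    by (rule gseries_sum[OF _ geom_bounded_bounded_linear[OF bounded_linear_mult_right geom_bounded_mpow]])
      (use assms in auto)
  also have "\<dots> = (\<Sum>t\<in>{1..N}. X p t * res N X u t q)"
    unfolding res_def
    by (intro sum.cong refl gseries_bounded_linear[OF bounded_linear_mult_right geom_bounded_mpow, symmetric])
      (use assms in auto)
  finally show ?thesis .
qed

lemma res_right:
  assumes "rad N X < u" "p \<in> {1..N}" "q \<in> {1..N}"
  shows "u *\<^sub>R res N X u p q = (if p = q then 1 else 0) + (\<Sum>t\<in>{1..N}. res N X u p t * X t q)"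
proof -
  have "u *\<^sub>R res N X u p q = (if p = q then 1 else 0)
      + gseries (\<lambda>k. \<Sum>t\<in>{1..N}. mpow N X k p t * X t q) u"
    unfolding res_def
    by (subst gseries_shift[OF geom_bounded_mpow]) (use assms in \<open>auto simp: mpow_Suc_right simp del: mpow.simps(2)\<close>)
  also have "gseries (\<lambda>k. \<Sum>t\<in>{1..N}. mpow N X k p t * X t q) u
      = (\<Sum>t\<in>{1..N}. gseries (\<lambda>k. mpow N X k p t * X t q) u)"
    by (rule gseries_sum[OF _ geom_bounded_bounded_linear[OF bounded_linear_mult_left geom_bounded_mpow]])
      (use assms in auto)
  also have "\<dots> = (\<Sum>t\<in>{1..N}. res N X u p t * X t q)"
    unfolding res_def
    by (intro sum.cong refl gseries_bounded_linear[OF bounded_linear_mult_left geom_bounded_mpow, symmetric])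
      (use assms in auto)
  finally show ?thesis .
qed

text \<open>R(v) X R(u) is evaluated twice, by the left equation for R(u) and by the right equation
  for R(v); no two entries have to commute.\<close>

lemma resolvent_identity:
  assumes u: "rad N X < u" and v: "rad N X < v" and pq: "p \<in> {1..N}" "q \<in> {1..N}"
  shows "(u - v) *\<^sub>R (\<Sum>t\<in>{1..N}. res N X v p t * res N X u t q) = res N X v p q - res N X u p q"
proof -
  let ?R = "res N X" and ?I = "{1..N}"
  have "u *\<^sub>R (\<Sum>t\<in>?I. ?R v p t * ?R u t q) = (\<Sum>t\<in>?I. ?R v p t * (u *\<^sub>R ?R u t q))"
    by (simp add: scaleR_sum_right)
  also have "\<dots> = (\<Sum>t\<in>?I. ?R v p t * ((if t = q then 1 else 0) + (\<Sum>s\<in>?I. X t s * ?R u s q)))"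
    by (intro sum.cong refl) (use res_left[OF u] pq in auto)
  also have "\<dots> = ?R v p q + (\<Sum>t\<in>?I. \<Sum>s\<in>?I. ?R v p t * X t s * ?R u s q)"
    using pq by (simp add: distrib_left sum.distrib sum_distrib_left mult.assoc
        if_distrib[of "(*) c" for c] cong: if_cong)
  also have "(\<Sum>t\<in>?I. \<Sum>s\<in>?I. ?R v p t * X t s * ?R u s q)
      = (\<Sum>s\<in>?I. (\<Sum>t\<in>?I. ?R v p t * X t s) * ?R u s q)"
    unfolding sum_distrib_right by (rule sum.swap)
  also have "\<dots> = (\<Sum>s\<in>?I. (v *\<^sub>R ?R v p s - (if p = s then 1 else 0)) * ?R u s q)"
    by (intro sum.cong refl) (use res_right[OF v] pq in auto)
  also have "\<dots> = v *\<^sub>R (\<Sum>t\<in>?I. ?R v p t * ?R u t q) - ?R u p q"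
    using pq by (simp add: left_diff_distrib sum_subtractf scaleR_sum_right
        if_distrib[of "\<lambda>x. x * c" for c] cong: if_cong)
  finally show ?thesis by (simp add: scaleR_left_diff_distrib)
qed


text \<open>Multiplying by the resolvent from the left solves (u - X) x = y. The relations between
  resolvent entries below are found by exhibiting such a linear system for one column.\<close>

lemma res_solve:
  assumes u: "rad N X < u" and p: "p \<in> {1..N}"
    and eq: "\<And>q. q \<in> {1..N} \<Longrightarrow> u *\<^sub>R x q = y q + (\<Sum>t\<in>{1..N}. X q t * x t)"
  shows "x p = (\<Sum>q\<in>{1..N}. res N X u p q * y q)"
proof -
  let ?R = "res N X u" and ?I = "{1..N}"
  have "(\<Sum>q\<in>?I. ?R p q * y q) = (\<Sum>q\<in>?I. ?R p q * (u *\<^sub>R x q - (\<Sum>t\<in>?I. X q t * x t)))"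
    by (intro sum.cong refl) (simp add: eq)
  also have "\<dots> = u *\<^sub>R (\<Sum>q\<in>?I. ?R p q * x q) - (\<Sum>q\<in>?I. \<Sum>t\<in>?I. ?R p q * X q t * x t)"
    by (simp add: right_diff_distrib sum_subtractf scaleR_sum_right sum_distrib_left mult.assoc)
  also have "(\<Sum>q\<in>?I. \<Sum>t\<in>?I. ?R p q * X q t * x t) = (\<Sum>t\<in>?I. (\<Sum>q\<in>?I. ?R p q * X q t) * x t)"
    unfolding sum_distrib_right by (rule sum.swap)
  also have "\<dots> = (\<Sum>t\<in>?I. (u *\<^sub>R ?R p t - (if p = t then 1 else 0)) * x t)"
    by (intro sum.cong refl) (use res_right[OF u p] in simp)
  also have "\<dots> = u *\<^sub>R (\<Sum>q\<in>?I. ?R p q * x q) - x p"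
    using p by (simp add: left_diff_distrib sum_subtractf scaleR_sum_right
        if_distrib[of "\<lambda>x. x * c" for c] cong: if_cong)
  finally show ?thesis by simp
qed

lemma commute_mpow:
  assumes "\<And>p q. p \<in> {1..N} \<Longrightarrow> q \<in> {1..N} \<Longrightarrow> Z * X p q = X p q * Z"
    and "p \<in> {1..N}" "q \<in> {1..N}"
  shows "Z * mpow N X k p q = mpow N X k p q * Z"
  using assms(2,3)
proof (induction k arbitrary: p)
  case (Suc k)
  have "Z * (X p r * mpow N X k r q) = X p r * mpow N X k r q * Z" if "r \<in> {1..N}" for r
    using assms(1) Suc that by (metis mult.assoc)
  then show ?case by (simp add: sum_distrib_left sum_distrib_right)
qed simp

lemma commute_res:
  assumes "\<And>p q. p \<in> {1..N} \<Longrightarrow> q \<in> {1..N} \<Longrightarrow> Z * X p q = X p q * Z"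
    and "rad N X < u" "p \<in> {1..N}" "q \<in> {1..N}"
  shows "Z * res N X u p q = res N X u p q * Z"
  unfolding res_def
  using assms commute_mpow[OF assms(1,3,4)]
    gseries_bounded_linear[OF bounded_linear_mult_right[of Z] geom_bounded_mpow[OF assms(3,4)] assms(2)]
    gseries_bounded_linear[OF bounded_linear_mult_left[of Z] geom_bounded_mpow[OF assms(3,4)] assms(2)]
  by simp

text \<open>Shaped for covariance under E_rs: one product on the left, and on the right a reordered
  product and two delta terms.\<close>

lemma gseries_linear_relation:
  fixes f0 f1 f2 f3 :: "'a::banach \<Rightarrow> 'b::banach"
  assumes "bounded_linear f0" "bounded_linear f1" "bounded_linear f2" "bounded_linear f3"
    and D: "geom_bounded C0 M D0" "geom_bounded C1 M D1" "geom_bounded C2 M D2" "geom_bounded C3 M D3"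
    and "\<And>k. f0 (D0 k) = f1 (D1 k) + f2 (D2 k) + f3 (D3 k)" and "M < u"
  shows "f0 (gseries D0 u) = f1 (gseries D1 u) + f2 (gseries D2 u) + f3 (gseries D3 u)"
proof -
  obtain C1' C2' C3' where g: "geom_bounded C1' M (\<lambda>k. f1 (D1 k))"
    "geom_bounded C2' M (\<lambda>k. f2 (D2 k))" "geom_bounded C3' M (\<lambda>k. f3 (D3 k))"
    using geom_bounded_bounded_linear assms(2-4) D by metis
  have "f0 (gseries D0 u) = gseries (\<lambda>k. f1 (D1 k) + f2 (D2 k) + f3 (D3 k)) u"
    using gseries_bounded_linear[OF assms(1) D(1)] assms(9,10) by simp
  also have "\<dots> = gseries (\<lambda>k. f1 (D1 k)) u + gseries (\<lambda>k. f2 (D2 k)) u + gseries (\<lambda>k. f3 (D3 k)) u"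
    using gseries_add[OF geom_bounded_add[OF g(1,2)] g(3)] gseries_add[OF g(1,2)] assms(10) by simp
  finally show ?thesis
    using gseries_bounded_linear[OF assms(2) D(2)] gseries_bounded_linear[OF assms(3) D(3)]
      gseries_bounded_linear[OF assms(4) D(4)] assms(10) by simp
qed

section \<open>Covariance of the powers of the characteristic matrix\<close>

definition eps :: "nat \<Rightarrow> nat \<Rightarrow> real" where
  "eps m p = (-1) ^ par m p"

text \<open>The Koszul sign for exchanging E_pq and E_rs.\<close>

definition sg :: "nat \<Rightarrow> nat \<Rightarrow> nat \<Rightarrow> nat \<Rightarrow> nat \<Rightarrow> real" where
  "sg m p q r s = (-1) ^ ((par m p + par m q) * (par m r + par m s))"

lemma eps_mult_self [simp]: "eps m p * eps m p = 1"
  by (simp add: eps_def par_def)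

lemma eps_mult_self_left [simp]: "eps m p * (eps m p * x) = x"
  by (simp add: eps_def par_def)

text \<open>The parities (p)+(t) and (t)+(q) add up to (p)+(q) modulo 2, so Koszul signs multiply
  along a matrix product.\<close>

lemma sg_trans: "sg m r s p t * sg m r s t q = sg m r s p q"
  by (auto simp: sg_def par_def)

lemma sg_diag [simp]: "sg m r s p p = 1" "sg m p p r s = 1"
  by (auto simp: sg_def par_def)

lemma sg_swap: "sg m p q q p = eps m p * eps m q"
  by (auto simp: sg_def eps_def par_def)

text \<open>The two exponents differ by ((r)+(s)) + ((r)+(s))^2, which is even. This is the
  cancellation on which \<open>G_covariant\<close> rests.\<close>

lemma eps_sg: "eps m r * sg m r s p r = eps m s * sg m r s p s"
  by (auto simp: sg_def eps_def par_def)

lemma sum_of_bool_scaleR: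
  fixes f :: "'i \<Rightarrow> 'a::real_vector"
  assumes "finite A" "a \<in> A"
  shows "(\<Sum>t\<in>A. of_bool (a = t) *\<^sub>R f t) = f a"
  using assms by (simp add: of_bool_def if_distrib[of "\<lambda>c. c *\<^sub>R x" for x] cong: if_cong)

text \<open>The bracket is oriented as a reordering rule. Parity enters only through
  \<open>sg\<close>, so no grading operator is part of the structure.\<close>

locale gl_super =
  fixes m N :: nat and E :: "nat \<Rightarrow> nat \<Rightarrow> 'a::{real_normed_algebra_1,banach}"
  assumes bracket: "\<lbrakk>p \<in> {1..N}; q \<in> {1..N}; r \<in> {1..N}; s \<in> {1..N}\<rbrakk> \<Longrightarrow>
    E p q * E r s = sg m p q r s *\<^sub>R (E r s * E p q) + of_bool (q = r) *\<^sub>R E p s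
      - (sg m p q r s * of_bool (p = s)) *\<^sub>R E r q"
begin

definition B :: "nat \<Rightarrow> nat \<Rightarrow> 'a" where "B p q = eps m p *\<^sub>R E p q"
text \<open>With the sign \<open>(-1)\<^sup>(\<^sup>p\<^sup>)\<close> the entries of the powers of \<open>B\<close> transform like the \<open>E p q\<close> themselves.\<close>

definition G :: "nat \<Rightarrow> nat \<Rightarrow> nat \<Rightarrow> 'a" where "G k p q = eps m p *\<^sub>R mpow N B k p q"
definition GR :: "real \<Rightarrow> nat \<Rightarrow> nat \<Rightarrow> 'a" where "GR u p q = eps m p *\<^sub>R res N B u p q"
definition tau :: "real \<Rightarrow> 'a" where "tau u = (\<Sum>p\<in>{1..N}. GR u p p)"

lemma G_Suc: "G (Suc k) p q = (\<Sum>t\<in>{1..N}. eps m t *\<^sub>R (E p t * G k t q))"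
  by (simp add: G_def B_def scaleR_sum_right)

text \<open>E_rs is moved past E_pt and then past the entry (t,q) of the lower power. The
  contributions with t = s and t = r are both multiples of E_ps times the entry (r,q), with opposite
  coefficients by \<open>eps_sg\<close>; only delta terms at the outer indices p and q
  survive.\<close>

lemma G_covariant:
  assumes "r \<in> {1..N}" "s \<in> {1..N}" "p \<in> {1..N}" "q \<in> {1..N}"
  shows "E r s * G k p q = sg m r s p q *\<^sub>R (G k p q * E r s) + of_bool (s = p) *\<^sub>R G k r q
    - (sg m r s p q * of_bool (r = q)) *\<^sub>R G k p s"
  using assms
proof (induction k arbitrary: p q)
  case 0
  then show ?case
    by (auto simp: G_def sg_swap)
next
  case (Suc k)
  let ?I = "{1..N}"
  have "E r s * (eps m t *\<^sub>R (E p t * G k t q)) =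
      sg m r s p q *\<^sub>R (eps m t *\<^sub>R (E p t * G k t q) * E r s)
    + of_bool (s = t) *\<^sub>R ((eps m t * sg m r s p t) *\<^sub>R (E p t * G k r q))
    - (sg m r s p q * of_bool (r = q)) *\<^sub>R (eps m t *\<^sub>R (E p t * G k t s))
    + of_bool (s = p) *\<^sub>R (eps m t *\<^sub>R (E r t * G k t q))
    - of_bool (r = t) *\<^sub>R ((eps m t * sg m r s p t) *\<^sub>R (E p s * G k t q))" if t: "t \<in> ?I" for t
  proof -
    have "E r s * (E p t * G k t q) = (E r s * E p t) * G k t q"
      by (simp only: mult.assoc)
    also have "\<dots> = sg m r s p t *\<^sub>R (E p t * (E r s * G k t q))
      + of_bool (s = p) *\<^sub>R (E r t * G k t q) - (sg m r s p t * of_bool (r = t)) *\<^sub>R (E p s * G k t q)"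
      unfolding bracket[OF Suc.prems(1-3) t]
      by (simp only: mult.assoc distrib_right left_diff_distrib mult_scaleR_left)
    also have "E p t * (E r s * G k t q) = sg m r s t q *\<^sub>R (E p t * G k t q * E r s)
      + of_bool (s = t) *\<^sub>R (E p t * G k r q) - (sg m r s t q * of_bool (r = q)) *\<^sub>R (E p t * G k t s)"
      unfolding Suc.IH[OF Suc.prems(1,2) t Suc.prems(4)]
      by (simp only: mult.assoc distrib_left right_diff_distrib mult_scaleR_right)
    finally have eq: "E r s * (E p t * G k t q) = sg m r s p t *\<^sub>R (sg m r s t q *\<^sub>R (E p t * G k t q * E r s)
        + of_bool (s = t) *\<^sub>R (E p t * G k r q) - (sg m r s t q * of_bool (r = q)) *\<^sub>R (E p t * G k t s))
      + of_bool (s = p) *\<^sub>R (E r t * G k t q) - (sg m r s p t * of_bool (r = t)) *\<^sub>R (E p s * G k t q)" .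
    show ?thesis
      unfolding sg_trans[of m r s p t q, symmetric] mult_scaleR_right eq
      by (simp only: scaleR_right_distrib scaleR_right_diff_distrib scaleR_scaleR mult_scaleR_left
          mult_ac add_diff_eq diff_add_eq)
  qed
  then have "E r s * G (Suc k) p q = (\<Sum>t\<in>?I. sg m r s p q *\<^sub>R (eps m t *\<^sub>R (E p t * G k t q) * E r s)
    + of_bool (s = t) *\<^sub>R ((eps m t * sg m r s p t) *\<^sub>R (E p t * G k r q))
    - (sg m r s p q * of_bool (r = q)) *\<^sub>R (eps m t *\<^sub>R (E p t * G k t s))
    + of_bool (s = p) *\<^sub>R (eps m t *\<^sub>R (E r t * G k t q))
    - of_bool (r = t) *\<^sub>R ((eps m t * sg m r s p t) *\<^sub>R (E p s * G k t q)))"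
    unfolding G_Suc sum_distrib_left by (rule sum.cong[OF refl])
  also have "\<dots> = sg m r s p q *\<^sub>R (G (Suc k) p q * E r s)
    + (eps m s * sg m r s p s) *\<^sub>R (E p s * G k r q)
    - (sg m r s p q * of_bool (r = q)) *\<^sub>R G (Suc k) p s
    + of_bool (s = p) *\<^sub>R G (Suc k) r q
    - (eps m r * sg m r s p r) *\<^sub>R (E p s * G k r q)"
    using Suc.prems
    by (simp only: sum.distrib sum_subtractf sum_of_bool_scaleR G_Suc scaleR_sum_right sum_distrib_right
        finite_atLeastAtMost)
  also have "\<dots> = sg m r s p q *\<^sub>R (G (Suc k) p q * E r s) + of_bool (s = p) *\<^sub>R G (Suc k) r q
    - (sg m r s p q * of_bool (r = q)) *\<^sub>R G (Suc k) p s"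
    unfolding eps_sg[of m r s p] by simp
  finally show ?case .
qed

lemma geom_bounded_G:
  assumes "p \<in> {1..N}" "q \<in> {1..N}"
  shows "geom_bounded 1 (rad N B) (\<lambda>k. G k p q)"
proof -
  have "\<bar>eps m p\<bar> = 1" by (simp add: eps_def)
  then show ?thesis using geom_bounded_mpow[OF assms, of B] by (simp add: G_def geom_bounded_def)
qed

lemma GR_eq_gseries:
  assumes "p \<in> {1..N}" "q \<in> {1..N}" "rad N B < u"
  shows "GR u p q = gseries (\<lambda>k. G k p q) u"
  unfolding GR_def G_def res_def
  by (rule gseries_bounded_linear[OF bounded_linear_scaleR_right geom_bounded_mpow]) (use assms in auto)

lemma GR_covariant:
  assumes "r \<in> {1..N}" "s \<in> {1..N}" "p \<in> {1..N}" "q \<in> {1..N}" "rad N B < u"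
  shows "E r s * GR u p q = sg m r s p q *\<^sub>R (GR u p q * E r s) + of_bool (s = p) *\<^sub>R GR u r q
    - (sg m r s p q * of_bool (r = q)) *\<^sub>R GR u p s"
proof -
  have "E r s * gseries (\<lambda>k. G k p q) u = sg m r s p q *\<^sub>R (gseries (\<lambda>k. G k p q) u * E r s)
    + of_bool (s = p) *\<^sub>R gseries (\<lambda>k. G k r q) u
    + (- (sg m r s p q * of_bool (r = q))) *\<^sub>R gseries (\<lambda>k. G k p s) u"
  proof (rule gseries_linear_relation[where ?f0.0 = "(*) (E r s)"
        and ?f1.0 = "\<lambda>x. sg m r s p q *\<^sub>R (x * E r s)" and ?f2.0 = "(*\<^sub>R) (of_bool (s = p))"
        and ?f3.0 = "(*\<^sub>R) (- (sg m r s p q * of_bool (r = q)))"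
        and ?D0.0 = "\<lambda>k. G k p q" and ?D1.0 = "\<lambda>k. G k p q" and ?D2.0 = "\<lambda>k. G k r q"
        and ?D3.0 = "\<lambda>k. G k p s" and ?C0.0 = 1 and ?C1.0 = 1 and ?C2.0 = 1 and ?C3.0 = 1
        and M = "rad N B"])
    show "bounded_linear (\<lambda>x. sg m r s p q *\<^sub>R (x * E r s))"
      by (intro bounded_linear_intros)
    show "E r s * G k p q = sg m r s p q *\<^sub>R (G k p q * E r s) + of_bool (s = p) *\<^sub>R G k r q
      + (- (sg m r s p q * of_bool (r = q))) *\<^sub>R G k p s" for k
      by (subst G_covariant[OF assms(1-4)]) simp
  qed (intro bounded_linear_mult_right bounded_linear_scaleR_right geom_bounded_G assms)+
  then show ?thesis using assms by (simp add: GR_eq_gseries)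
qed

text \<open>On the diagonal all Koszul signs are 1, and each of the two delta terms sums to
  \<open>GR u r s\<close>.\<close>

lemma tau_central:
  assumes "r \<in> {1..N}" "s \<in> {1..N}" "rad N B < u"
  shows "tau u * E r s = E r s * tau u"
proof -
  have "E r s * tau u = (\<Sum>p\<in>{1..N}. GR u p p * E r s + of_bool (s = p) *\<^sub>R GR u r p - of_bool (r = p) *\<^sub>R GR u p s)"
    unfolding tau_def sum_distrib_left
    by (intro sum.cong refl) (subst GR_covariant[OF assms(1,2) _ _ assms(3)], simp_all)
  also have "\<dots> = tau u * E r s"
    using assms
    by (simp add: sum.distrib sum_subtractf sum_of_bool_scaleR tau_def sum_distrib_right del: of_bool_eq_iff)
  finally show ?thesis by simp
qed

lemma commute_B:
  assumes "\<And>p q. p \<in> {1..N} \<Longrightarrow> q \<in> {1..N} \<Longrightarrow> Z * E p q = E p q * Z"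
    and "p \<in> {1..N}" "q \<in> {1..N}"
  shows "Z * B p q = B p q * Z"
  using assms by (simp add: B_def)

end

lemma gl_super_mono:
  assumes "gl_super m N E" "L \<le> N"
  shows "gl_super m L E"
  by (rule gl_super.intro, rule gl_super.bracket[OF assms(1)]) (use assms(2) in auto)

section \<open>The difference equation for the corner of the resolvent\<close>

lemma neg_eq_neg_addD:
  fixes x :: "'b::ab_group_add"
  assumes "- x = - y + z"
  shows "x = y - z"
proof -
  have "x = - (- x)" by simp
  also have "\<dots> = y - z" unfolding assms by simp
  finally show ?thesis .
qed

context gl_super
begin

lemma GR_NN_commute:
  assumes "N = Suc L" "a \<in> {1..L}" "b \<in> {1..L}" "rad N B < u"
  shows "res N B u N N * E a b = E a b * res N B u N N"
proof -
  have "E a b * GR u N N = GR u N N * E a b"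
    by (subst GR_covariant) (use assms in auto)
  then show ?thesis by (simp add: GR_def eps_def)
qed

text \<open>The column above the corner solves (u - B) R_aN = B_aN c. Putting c on the left of B_aN
  costs the term -R_aN, because N is odd, and this replaces u by u + 1. Then c leaves the sum, as it
  commutes with the smaller algebra.\<close>

lemma res_column_shift:
  assumes N: "N = Suc L" "m \<le> L" and a: "a \<in> {1..L}" and u: "rad N B < u"
  shows "res N B u a N = res N B u N N * (\<Sum>b\<in>{1..L}. res L B (u + 1) a b * B b N)"
proof -
  let ?R = "res N B u" and ?c = "res N B u N N"
  have L: "rad L B < u + 1"
    using rad_mono[of L N B] N u by simp
  have BN: "B b N * ?c = ?c * B b N - ?R b N" if b: "b \<in> {1..L}" for b
  proof -
    have e: "eps m N = -1" using N by (simp add: eps_def par_def)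
    have "E b N * GR u N N = GR u N N * E b N + GR u b N"
      by (subst GR_covariant) (use N b u in auto)
    then have "- (E b N * ?c) = - (?c * E b N) + eps m b *\<^sub>R ?R b N"
      by (simp add: GR_def e)
    then have "E b N * ?c = ?c * E b N - eps m b *\<^sub>R ?R b N"
      by (rule neg_eq_neg_addD)
    then show ?thesis
      by (simp add: B_def scaleR_right_diff_distrib)
  qed
  have "?R a N = (\<Sum>b\<in>{1..L}. res L B (u + 1) a b * (?c * B b N))"
  proof (rule res_solve[OF L a])
    fix q assume q: "q \<in> {1..L}"
    have "u *\<^sub>R ?R q N = (\<Sum>t\<in>{1..N}. B q t * ?R t N)"
      using res_left[OF u, of q N] q N by auto
    also have "\<dots> = (\<Sum>t\<in>{1..L}. B q t * ?R t N) + B q N * ?c"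
      using N(1) by simp
    finally show "(u + 1) *\<^sub>R ?R q N = ?c * B q N + (\<Sum>t\<in>{1..L}. B q t * ?R t N)"
      using BN[OF q] by (simp add: scaleR_left_distrib)
  qed
  also have "\<dots> = (\<Sum>b\<in>{1..L}. ?c * (res L B (u + 1) a b * B b N))"
  proof (rule sum.cong[OF refl])
    fix b assume b: "b \<in> {1..L}"
    have "?c * res L B (u + 1) a b = res L B (u + 1) a b * ?c"
      by (rule commute_res[OF _ L a b]) (simp add: B_def GR_NN_commute[OF N(1) _ _ u])
    then show "res L B (u + 1) a b * (?c * B b N) = ?c * (res L B (u + 1) a b * B b N)"
      by (simp only: mult.assoc[symmetric])
  qed
  finally show ?thesis by (simp add: sum_distrib_left)
qed

text \<open>Block inversion at u + 1: the two diagonal entries differ by the column (resolvent of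
  the small block times B_bN) times the row entry at (N,a). By \<open>res_column_shift\<close>, c
  times that column is the column at u.\<close>

lemma column_row_product:
  assumes N: "N = Suc L" "m \<le> L" and a: "a \<in> {1..L}" and u: "rad N B < u"
  shows "res N B u a N * res N B (u + 1) N a =
    res N B u N N * (res N B (u + 1) a a - res L B (u + 1) a a)"
proof -
  let ?v = "u + 1"
  let ?R = "res N B ?v" and ?R' = "res L B ?v"
  have v: "rad N B < ?v" using u by simp
  have L: "rad L B < ?v"
    using rad_mono[of L N B] N u by simp
  have "?R a a = (\<Sum>b\<in>{1..L}. ?R' a b * (B b N * ?R N a + (if b = a then 1 else 0)))"
  proof (rule res_solve[OF L a, where x = "\<lambda>q. ?R q a"])
    fix q assume q: "q \<in> {1..L}"
    show "?v *\<^sub>R ?R q a = B q N * ?R N a + (if q = a then 1 else 0) + (\<Sum>t\<in>{1..L}. B q t * ?R t a)"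
      by (subst res_left[OF v]) (use q a N in \<open>auto simp: sum.cl_ivl_Suc\<close>)
  qed
  also have "\<dots> = (\<Sum>b\<in>{1..L}. ?R' a b * B b N) * ?R N a + ?R' a a"
    using a by (simp add: distrib_left sum.distrib sum_distrib_right mult.assoc
        if_distrib[of "(*) c" for c] cong: if_cong)
  finally have "(\<Sum>b\<in>{1..L}. ?R' a b * B b N) * ?R N a = ?R a a - ?R' a a" by simp
  then show ?thesis
    using res_column_shift[OF N a u] by (simp add: mult.assoc)
qed

text \<open>As a column in its first index, the supercommutator of R_pN(u) with R_Ns(v) is
  annihilated by u - B except for the delta terms left over when B_pt passes R_Ns(v).
  \<open>res_solve\<close> turns these terms into the right side.\<close>

lemma res_exchange:
  assumes N: "N = Suc L" "m \<le> L" and s: "s \<in> {1..N}" and u: "rad N B < u" and v: "rad N B < v"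
    and y: "y \<in> {1..N}"
  shows "res N B u y N * res N B v N s - sg m y N N s *\<^sub>R (res N B v N s * res N B u y N)
    = res N B u y s * (\<Sum>t\<in>{1..N}. res N B v N t * res N B u t N)
      - (\<Sum>t\<in>{1..N}. res N B u y t * res N B v t s) * res N B u N N"
proof -
  let ?I = "{1..N}" and ?R = "res N B u" and ?S = "res N B v"
  define Y where "Y = ?S N s"
  define W where "W = (\<Sum>t\<in>?I. ?S N t * ?R t N)"
  define x where "x p = ?R p N * Y - sg m p N N s *\<^sub>R (Y * ?R p N)" for p
  have NI: "N \<in> ?I" using N by simp
  have eN: "eps m N = -1" using N by (simp add: eps_def par_def)
  have comm: "B p t * Y = sg m p t N s *\<^sub>R (Y * B p t)
      - of_bool (N = t) *\<^sub>R ?S p s - (eps m p * sg m p t N s * of_bool (p = s)) *\<^sub>R ?S N t"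
    if "p \<in> ?I" "t \<in> ?I" for p t
  proof -
    have "E p t * GR v N s = sg m p t N s *\<^sub>R (GR v N s * E p t) + of_bool (t = N) *\<^sub>R GR v p s
      - (sg m p t N s * of_bool (p = s)) *\<^sub>R GR v N t"
      by (rule GR_covariant) (use that NI s v in auto)
    then have "- (E p t * Y) = - (sg m p t N s *\<^sub>R (Y * E p t)) + (of_bool (N = t) *\<^sub>R (eps m p *\<^sub>R ?S p s)
      + (sg m p t N s * of_bool (p = s)) *\<^sub>R ?S N t)"
      by (simp add: GR_def eN Y_def eq_commute[of N t])
    then have "E p t * Y = sg m p t N s *\<^sub>R (Y * E p t) - of_bool (N = t) *\<^sub>R (eps m p *\<^sub>R ?S p s)
      - (sg m p t N s * of_bool (p = s)) *\<^sub>R ?S N t"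
      unfolding diff_diff_eq by (rule neg_eq_neg_addD)
    then show ?thesis
      by (simp add: B_def scaleR_right_diff_distrib mult_ac)
  qed
  have "x y = (\<Sum>p\<in>?I. ?R y p * (of_bool (p = s) *\<^sub>R W - ?S p s * ?R N N))"
  proof (rule res_solve[OF u y])
    fix p assume p: "p \<in> ?I"
    have sgt: "sg m t N N s * sg m p t N s = sg m p N N s" for t
      by (auto simp: sg_def par_def)
    have "(\<Sum>t\<in>?I. sg m t N N s *\<^sub>R (B p t * (Y * ?R t N)))
      = (\<Sum>t\<in>?I. sg m p N N s *\<^sub>R (Y * (B p t * ?R t N))
          - of_bool (N = t) *\<^sub>R (sg m t N N s *\<^sub>R (?S p s * ?R t N))
          - (eps m p * sg m p N N s * of_bool (p = s)) *\<^sub>R (?S N t * ?R t N))"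
    proof (rule sum.cong[OF refl])
      fix t assume t: "t \<in> ?I"
      have "B p t * (Y * ?R t N) = (B p t * Y) * ?R t N" by (simp only: mult.assoc)
      also have "\<dots> = sg m p t N s *\<^sub>R (Y * (B p t * ?R t N)) - of_bool (N = t) *\<^sub>R (?S p s * ?R t N)
          - (eps m p * sg m p t N s * of_bool (p = s)) *\<^sub>R (?S N t * ?R t N)"
        unfolding comm[OF p t] by (simp only: left_diff_distrib mult_scaleR_left mult.assoc)
      finally show "sg m t N N s *\<^sub>R (B p t * (Y * ?R t N)) = sg m p N N s *\<^sub>R (Y * (B p t * ?R t N))
          - of_bool (N = t) *\<^sub>R (sg m t N N s *\<^sub>R (?S p s * ?R t N))
          - (eps m p * sg m p N N s * of_bool (p = s)) *\<^sub>R (?S N t * ?R t N)"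
        unfolding sgt[of t, symmetric]
        by (simp only: scaleR_right_diff_distrib scaleR_scaleR mult_ac)
    qed
    also have "\<dots> = sg m p N N s *\<^sub>R (Y * (\<Sum>t\<in>?I. B p t * ?R t N)) - ?S p s * ?R N N
        - (eps m p * sg m p N N s * of_bool (p = s)) *\<^sub>R W"
      using NI by (simp only: sum_subtractf sum_of_bool_scaleR finite_atLeastAtMost W_def sg_diag
          scaleR_one scaleR_sum_right sum_distrib_left)
    also have "(eps m p * sg m p N N s * of_bool (p = s)) *\<^sub>R W = - (of_bool (p = s) *\<^sub>R W)"
      using eN by (auto simp: sg_swap)
    finally have sum: "(\<Sum>t\<in>?I. sg m t N N s *\<^sub>R (B p t * (Y * ?R t N)))
      = sg m p N N s *\<^sub>R (Y * (\<Sum>t\<in>?I. B p t * ?R t N)) - ?S p s * ?R N N + of_bool (p = s) *\<^sub>R W"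
      by simp
    have "u *\<^sub>R x p = (u *\<^sub>R ?R p N) * Y - sg m p N N s *\<^sub>R (Y * (u *\<^sub>R ?R p N))"
      by (simp add: x_def scaleR_right_diff_distrib mult_ac)
    also have "\<dots> = (\<Sum>t\<in>?I. B p t * ?R t N) * Y - sg m p N N s *\<^sub>R (Y * (\<Sum>t\<in>?I. B p t * ?R t N))"
      unfolding res_left[OF u p NI] by (auto simp: distrib_left distrib_right)
    also have "(\<Sum>t\<in>?I. B p t * ?R t N) * Y = (\<Sum>t\<in>?I. B p t * x t)
        + (\<Sum>t\<in>?I. sg m t N N s *\<^sub>R (B p t * (Y * ?R t N)))"
      by (simp add: x_def right_diff_distrib sum_subtractf sum_distrib_right mult.assoc)
    finally show "u *\<^sub>R x p = (of_bool (p = s) *\<^sub>R W - ?S p s * ?R N N) + (\<Sum>t\<in>?I. B p t * x t)"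
      unfolding sum by simp
  qed
  also have "\<dots> = (\<Sum>p\<in>?I. of_bool (s = p) *\<^sub>R (?R y p * W)) - (\<Sum>p\<in>?I. ?R y p * ?S p s) * ?R N N"
    by (simp add: right_diff_distrib sum_subtractf sum_distrib_right mult.assoc eq_commute[of s])
  also have "(\<Sum>p\<in>?I. of_bool (s = p) *\<^sub>R (?R y p * W)) = ?R y s * W"
    by (rule sum_of_bool_scaleR[OF _ s]) simp
  finally show ?thesis unfolding x_def Y_def W_def .
qed

text \<open>The sum \<open>\<Sum>\<^sub>p (-1)\<^sup>(\<^sup>p\<^sup>) R\<^sub>p\<^sub>N(u) R\<^sub>N\<^sub>p(u + 1)\<close> is evaluated through \<open>column_row_product\<close> and
  through \<open>res_exchange\<close>.\<close>

theorem res_corner_difference_equation: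
  assumes N: "N = Suc L" "m \<le> L" and u: "rad N B < u"
  shows "(1 - tau u) * res N B (u + 1) N N = res N B u N N * (1 - gl_super.tau m L E (u + 1))"
proof -
  interpret sub: gl_super m L E
    by (rule gl_super_mono[OF gl_super_axioms]) (simp add: N)
  let ?v = "u + 1" and ?I = "{1..N}"
  let ?R = "res N B u" and ?S = "res N B ?v"
  define c where "c = ?R N N"
  define c' where "c' = ?S N N"
  have v: "rad N B < ?v" using u by simp
  have NI: "N \<in> ?I" using N by simp
  have eN: "eps m N = -1" using N by (simp add: eps_def par_def)
  have split: "sum f ?I = sum f {1..L} + f N" for f :: "nat \<Rightarrow> 'a"
    using N(1) by simp
  have tauN: "tau w = (\<Sum>a\<in>{1..L}. eps m a *\<^sub>R res N B w a a) - res N B w N N" for w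
    unfolding tau_def split by (simp add: GR_def eN)
  define S where "S = (\<Sum>p\<in>?I. eps m p *\<^sub>R (?R p N * ?S N p))"
  have "S = (\<Sum>a\<in>{1..L}. eps m a *\<^sub>R (?R a N * ?S N a)) - c * c'"
    unfolding S_def split by (simp add: c_def c'_def eN)
  also have "(\<Sum>a\<in>{1..L}. eps m a *\<^sub>R (?R a N * ?S N a))
      = (\<Sum>a\<in>{1..L}. c * (eps m a *\<^sub>R ?S a a - eps m a *\<^sub>R res L B ?v a a))"
    by (intro sum.cong refl)
      (simp add: column_row_product[OF N _ u] c_def scaleR_right_diff_distrib[symmetric])
  also have "\<dots> = c * (tau ?v + c' - sub.tau ?v)"
    by (simp add: sum_distrib_left[symmetric] sum_subtractf tauN c'_def sub.tau_def sub.GR_def)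
  finally have S1: "S = c * (tau ?v - sub.tau ?v)"
    by (simp add: algebra_simps)
  have W: "(\<Sum>t\<in>?I. ?S N t * ?R t N) = c - c'"
    using resolvent_identity[OF u v NI NI] unfolding c_def c'_def
    by (intro neg_eq_neg_addD) simp
  \<comment> \<open>Since N is odd, the signs in front of the reversed products cancel to +1, so
    these products sum to the corner of R(u+1) R(u). By the resolvent identity that is c -
    c'.\<close>
  have "S + (c - c') = (\<Sum>p\<in>?I. eps m p *\<^sub>R (?R p N * ?S N p - sg m p N N p *\<^sub>R (?S N p * ?R p N)))"
    unfolding S_def W[symmetric] sum.distrib[symmetric]
    by (intro sum.cong refl) (simp add: sg_swap eN scaleR_right_diff_distrib scaleR_right_distrib)
  also have "\<dots> = (\<Sum>p\<in>?I. eps m p *\<^sub>R (?R p p * (c - c') - (?R p p - ?S p p) * c))"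
  proof (intro sum.cong refl)
    fix p assume p: "p \<in> ?I"
    have "(\<Sum>t\<in>?I. ?R p t * ?S t p) = ?R p p - ?S p p"
      using resolvent_identity[OF v u p p] by simp
    then show "eps m p *\<^sub>R (?R p N * ?S N p - sg m p N N p *\<^sub>R (?S N p * ?R p N))
        = eps m p *\<^sub>R (?R p p * (c - c') - (?R p p - ?S p p) * c)"
      using res_exchange[OF N p u v p] W by (simp add: c_def)
  qed
  also have "\<dots> = (\<Sum>p\<in>?I. GR ?v p p * c - GR u p p * c')"
    by (intro sum.cong refl) (simp add: GR_def algebra_simps)
  also have "\<dots> = tau ?v * c - tau u * c'"
    by (simp add: sum_subtractf tau_def sum_distrib_right)
  finally have S2: "S + (c - c') = tau ?v * c - tau u * c'" .
  have comm: "tau ?v * c = c * tau ?v"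
    unfolding c_def
    by (rule commute_res[OF commute_B[OF tau_central[OF _ _ v]] u NI NI]) auto
  show ?thesis
    using S2[unfolded S1 comm] unfolding c_def[symmetric] c'_def[symmetric] by (simp add: algebra_simps)
qed

end

section \<open>The supertrace on singular vectors\<close>

lemma mat_mult_vec: "mat c *v (x :: complex^'d) = c *s x"
  by (simp add: vec_eq_iff matrix_vector_mult_def mat_def if_distrib[of "\<lambda>a. a * b" for b] cong: if_cong)

lemma scaleR_conv_smult: "r *\<^sub>R (x :: complex^'d) = of_real r *s x"
  by (simp add: vec_eq_iff scaleR_conv_of_real[where 'a=complex])

text \<open>Peeling off the smallest index preserves the recursion, so the partial sums telescope
  into a product.\<close>

lemma triangular_recursion:
  fixes v :: "complex^'d" and rk :: "nat \<Rightarrow> int" and b e :: "nat \<Rightarrow> complex"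
  assumes "finite A" "inj_on rk A" "\<And>p. p \<in> A \<Longrightarrow> u \<noteq> b p"
    and "\<And>p. p \<in> A \<Longrightarrow> (u - b p) *s y p = v - (\<Sum>t\<in>{t\<in>A. rk p < rk t}. e t *s y t)"
  shows "v - (\<Sum>t\<in>A. e t *s y t) = (\<Prod>p\<in>A. (u - b p - e p) / (u - b p)) *s v"
  using assms
proof (induction A rule: finite_psubset_induct)
  case (psubset A)
  show ?case
  proof (cases "A = {}")
    case False
    define p where "p = arg_min_on rk A"
    have p: "p \<in> A" "\<And>t. t \<in> A \<Longrightarrow> rk p \<le> rk t"
      unfolding p_def using arg_min_if_finite[OF psubset(1) False, of rk] by (auto simp: not_less)
    have up: "{t\<in>A. rk p < rk t} = A - {p}"
      using p inj_onD[OF psubset.prems(1)] by (auto simp: less_le)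
    let ?s = "\<Sum>t\<in>A - {p}. e t *s y t" and ?f = "\<lambda>p. (u - b p - e p) / (u - b p)"
    have IH: "v - ?s = (\<Prod>p\<in>A - {p}. ?f p) *s v"
    proof (rule psubset.IH)
      show "A - {p} \<subset> A" using p by auto
      show "inj_on rk (A - {p})" using psubset.prems(1) by (rule inj_on_subset) auto
      fix q assume q: "q \<in> A - {p}"
      show "u \<noteq> b q" using q psubset.prems(2) by auto
      have "{t\<in>A - {p}. rk q < rk t} = {t\<in>A. rk q < rk t}"
        using p(2)[of q] q by force
      then show "(u - b q) *s y q = v - (\<Sum>t\<in>{t\<in>A - {p}. rk q < rk t}. e t *s y t)"
        using psubset.prems(3)[of q] q by simp
    qed
    have ne: "u - b p \<noteq> 0" using psubset.prems(2)[OF p(1)] by simp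
    have "(u - b p) *s y p = v - ?s" using psubset.prems(3)[OF p(1)] up by simp
    then have y: "y p = (1 / (u - b p)) *s (v - ?s)"
      using ne by (metis vector_smult_assoc nonzero_eq_divide_eq vector_smult_lid)
    have "v - (\<Sum>t\<in>A. e t *s y t) = (v - ?s) - e p *s y p"
      by (simp add: sum.remove[OF psubset(1) p(1)] algebra_simps)
    also have "\<dots> = ?f p *s (v - ?s)"
      unfolding y using ne by (simp add: vec_eq_iff field_simps)
    also have "\<dots> = (\<Prod>p\<in>A. ?f p) *s v"
      unfolding IH by (simp add: prod.remove[OF psubset(1) p(1)] vector_smult_assoc)
    finally show ?thesis .
  qed simp
qed

lemma app_res_smult:
  fixes X :: "nat \<Rightarrow> nat \<Rightarrow> (complex^'d) endo"
  assumes "\<And>p q c. p \<in> {1..K} \<Longrightarrow> q \<in> {1..K} \<Longrightarrow> mat_endo (mat c) * X p q = X p q * mat_endo (mat c)"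
    and "rad K X < u" "p \<in> {1..K}" "q \<in> {1..K}"
  shows "app (res K X u p q) (c *s x) = c *s app (res K X u p q) x"
proof -
  have "mat_endo (mat c) * res K X u p q = res K X u p q * mat_endo (mat c)"
    by (rule commute_res[OF assms])
  then have "app (mat_endo (mat c) * res K X u p q) x = app (res K X u p q * mat_endo (mat c)) x"
    by simp
  then show ?thesis by (simp add: mat_mult_vec)
qed

text \<open>With y_p = R_pp v, the equation u y_p = v + sum of B_pt R_tp v is triangular: R_tp v
  vanishes for t below p, and for t above p covariance gives B_pt R_tp v = (-1)^(t) (y_p - y_t). The
  y_p parts shift the signed weight of E_pp to the root b_p, and the y_t parts form the
  recursion.\<close>

lemma tau_singular_vector:
  fixes E :: "nat \<Rightarrow> nat \<Rightarrow> (complex^'d) endo" and rk :: "nat \<Rightarrow> int" and v :: "complex^'d"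
  assumes gl: "gl_super m K E"
    and clin: "\<And>p q c. p \<in> {1..K} \<Longrightarrow> q \<in> {1..K} \<Longrightarrow> mat_endo (mat c) * E p q = E p q * mat_endo (mat c)"
    and rk: "inj_on rk {1..K}"
    and sing: "\<And>p q. p \<in> {1..K} \<Longrightarrow> q \<in> {1..K} \<Longrightarrow> rk p < rk q \<Longrightarrow> app (E p q) v = 0"
    and weight: "\<And>p. p \<in> {1..K} \<Longrightarrow> app (E p p) v = L p *s v"
    and b: "\<And>p. p \<in> {1..K} \<Longrightarrow>
      b p = of_real (eps m p) * L p + (\<Sum>t\<in>{t\<in>{1..K}. rk p < rk t}. of_real (eps m t))"
    and u: "rad K (gl_super.B m E) < u" and ub: "\<And>p. p \<in> {1..K} \<Longrightarrow> of_real u \<noteq> b p"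
  shows "v - app (gl_super.tau m K E u) v
    = (\<Prod>p\<in>{1..K}. (of_real u - b p - of_real (eps m p)) / (of_real u - b p)) *s v"
proof -
  interpret gl_super m K E by (rule gl)
  let ?I = "{1..K}" and ?R = "res K B u"
  define y where "y p = app (?R p p) v" for p
  have clinB: "mat_endo (mat c) * B p q = B p q * mat_endo (mat c)" if "p \<in> ?I" "q \<in> ?I" for p q c
    using clin[OF that] by (simp add: B_def)
  have G0: "app (G k t p) v = 0" if "t \<in> ?I" "p \<in> ?I" "rk t < rk p" for k t p
    using that
  proof (induction k arbitrary: t)
    case 0
    then show ?case by (auto simp: G_def app.zero_left)
  next
    case (Suc k)
    \<comment> \<open>If s is below p, the induction hypothesis applies. Otherwise t is below s, so
      E_ts kills v once it has passed the entry (s,p), and the leftover entry (t,p) falls under the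
      hypothesis.\<close>
    have "app (E t s * G k s p) v = 0" if s: "s \<in> ?I" for s
    proof (cases "rk s < rk p")
      case True
      then show ?thesis using Suc.IH[OF s] Suc.prems by (simp add: app.zero_right)
    next
      case False
      have "app (E t s * G k s p) v = sg m t s s p *\<^sub>R app (G k s p) (app (E t s) v) + app (G k t p) v"
        by (subst G_covariant) (use s Suc.prems in \<open>auto simp: app.add_left app.scaleR_left\<close>)
      then show ?thesis
        using sing[OF Suc.prems(1) s] False Suc by (simp add: app.zero_right)
    qed
    then show ?case
      unfolding G_Suc by (simp add: app.sum_left app.scaleR_left)
  qed
  have R0: "app (?R t p) v = 0" if "t \<in> ?I" "p \<in> ?I" "rk t < rk p" for t p
  proof -
    have "app (GR u t p) v = gseries (\<lambda>k. app (G k t p) v) u"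
      unfolding GR_eq_gseries[OF that(1,2) u]
      by (rule gseries_bounded_linear[OF app.bounded_linear_left geom_bounded_G[OF that(1,2)] u])
    also have "\<dots> = 0" by (simp add: G0[OF that] gseries_def)
    finally show ?thesis by (simp add: GR_def app.scaleR_left eps_def)
  qed
  have diag: "app (B p p) (y p) = (of_real (eps m p) * L p) *s y p" if p: "p \<in> ?I" for p
  proof -
    have "E p p * GR u p p = GR u p p * E p p"
      by (subst GR_covariant) (use p u in auto)
    then have "B p p * ?R p p = ?R p p * B p p"
      by (simp add: GR_def B_def eps_def)
    then have "app (B p p) (y p) = app (?R p p) (app (B p p) v)"
      unfolding y_def by (metis app_mult)
    also have "app (B p p) v = (of_real (eps m p) * L p) *s v"
      using weight[OF p] by (simp add: B_def app.scaleR_left scaleR_conv_smult vector_smult_assoc)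
    finally show ?thesis
      using app_res_smult[OF clinB u p p] by (simp add: y_def)
  qed
  have upper: "app (B p t) (app (?R t p) v) = of_real (eps m t) *s y p - of_real (eps m t) *s y t"
    if p: "p \<in> ?I" and t: "t \<in> ?I" and lt: "rk p < rk t" for p t
  proof -
    have "app (E p t * GR u t p) v = app (GR u p p) v - sg m p t t p *\<^sub>R app (GR u t t) v"
      by (subst GR_covariant)
        (use p t u sing[OF p t lt] in \<open>auto simp: app.add_left app.diff_left app.scaleR_left app.zero_right\<close>)
    moreover have "app (E p t * ?R t p) v = eps m t *\<^sub>R app (E p t * GR u t p) v"
      by (simp add: GR_def app.scaleR_left app.scaleR_right)
    ultimately have "app (E p t * ?R t p) v = eps m t *\<^sub>R (eps m p *\<^sub>R y p - eps m p *\<^sub>R y t)"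
      by (simp add: GR_def app.scaleR_left sg_swap y_def mult_ac)
    then have "app (B p t) (app (?R t p) v) = eps m t *\<^sub>R y p - eps m t *\<^sub>R y t"
      by (simp add: B_def app.scaleR_left scaleR_right_diff_distrib mult_ac)
    then show ?thesis by (simp add: scaleR_conv_smult)
  qed
  have rec: "(of_real u - b p) *s y p = v - (\<Sum>t\<in>{t\<in>?I. rk p < rk t}. of_real (eps m t) *s y t)"
    if p: "p \<in> ?I" for p
  proof -
    let ?U = "{t\<in>?I. rk p < rk t}"
    have "of_real u *s y p = app (u *\<^sub>R ?R p p) v"
      by (simp add: y_def app.scaleR_left scaleR_conv_smult)
    also have "\<dots> = v + (\<Sum>t\<in>?I. app (B p t) (app (?R t p) v))"
      unfolding res_left[OF u p p] by (simp add: app.add_left app.sum_left)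
    also have "(\<Sum>t\<in>?I. app (B p t) (app (?R t p) v)) = app (B p p) (y p)
        + (\<Sum>t\<in>?I - {p}. app (B p t) (app (?R t p) v))"
      unfolding y_def by (rule sum.remove) (use p in auto)
    also have "(\<Sum>t\<in>?I - {p}. app (B p t) (app (?R t p) v))
        = (\<Sum>t\<in>?U. of_real (eps m t) *s y p - of_real (eps m t) *s y t)"
    proof (rule sum.mono_neutral_cong_right)
      show "\<forall>t\<in>?I - {p} - ?U. app (B p t) (app (?R t p) v) = 0"
      proof
        fix t assume t: "t \<in> ?I - {p} - ?U"
        then have "rk t < rk p" using inj_onD[OF rk, of t p] p by force
        then show "app (B p t) (app (?R t p) v) = 0"
          using R0[of t p] t p by (simp add: app.zero_right)
      qed
    qed (use p upper in auto)
    also have "\<dots> = (\<Sum>t\<in>?U. of_real (eps m t)) *s y p - (\<Sum>t\<in>?U. of_real (eps m t) *s y t)"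
      by (simp add: sum_subtractf vec.scale_sum_left)
    finally show ?thesis
      unfolding diag[OF p] b[OF p] by (simp add: vec_eq_iff algebra_simps)
  qed
  have "app (tau u) v = (\<Sum>t\<in>?I. of_real (eps m t) *s y t)"
    by (simp add: tau_def GR_def app.sum_left app.scaleR_left scaleR_conv_smult y_def)
  then show ?thesis
    using triangular_recursion[of ?I rk "of_real u" b y v "\<lambda>t. of_real (eps m t)"] rk ub rec
    by simp
qed

section \<open>Branching of highest weights\<close>

lemma psign_mult_self [simp]: "psign k * psign k = 1"
  by (simp add: psign_def power_mult_distrib[symmetric])

lemma rep_bracket:
  assumes "is_gl_super_rep m N rho P" "p \<in> {1..N}" "q \<in> {1..N}" "r \<in> {1..N}" "s \<in> {1..N}"
  shows "rho p q *v (rho r s *v x) =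
    psign ((par m p + par m q) * (par m r + par m s)) *s (rho r s *v (rho p q *v x))
    + (if q = r then rho p s *v x else 0)
    - psign ((par m p + par m q) * (par m r + par m s)) *s (if p = s then rho r q *v x else 0)"
proof -
  let ?g = "psign ((par m p + par m q) * (par m r + par m s))"
  have "rho p q ** rho r s - mat ?g ** (rho r s ** rho p q)
      = (if q = r then rho p s else 0) - mat ?g ** (if p = s then rho r q else 0)"
    using assms unfolding is_gl_super_rep_def by blast
  then have "(rho p q ** rho r s - mat ?g ** (rho r s ** rho p q)) *v x
      = ((if q = r then rho p s else 0) - mat ?g ** (if p = s then rho r q else 0)) *v x"
    by simp
  then show ?thesis
    by (simp add: matrix_vector_mult_diff_rdistrib matrix_vector_mul_assoc[symmetric] mat_mult_vec
        diff_eq_eq split: if_splits)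
qed

lemma rep_parity:
  assumes "is_gl_super_rep m N rho P" "p \<in> {1..N}" "q \<in> {1..N}"
  shows "P *v (rho p q *v x) = psign (par m p + par m q) *s (rho p q *v (P *v x))"
proof -
  have "rho p q ** P = mat (psign (par m p + par m q)) ** (P ** rho p q)"
    using assms unfolding is_gl_super_rep_def by blast
  then have "(rho p q ** P) *v x = (mat (psign (par m p + par m q)) ** (P ** rho p q)) *v x"
    by simp
  then have "rho p q *v (P *v x) = psign (par m p + par m q) *s (P *v (rho p q *v x))"
    by (simp add: matrix_vector_mul_assoc[symmetric] mat_mult_vec)
  then show ?thesis by (simp add: vector_smult_assoc)
qed

section \<open>Comparing highest weights through a bilinear pairing\<close>

definition cdot :: "complex^'d \<Rightarrow> complex^'d \<Rightarrow> complex" where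
  "cdot a y = (\<Sum>i\<in>UNIV. a $ i * y $ i)"

lemma cdot_add: "cdot a (x + y) = cdot a x + cdot a y"
  by (simp add: cdot_def algebra_simps sum.distrib)

lemma cdot_smult: "cdot a (c *s x) = c * cdot a x"
  by (simp add: cdot_def sum_distrib_left mult_ac)

text \<open>The pairing is bilinear rather than Hermitian, so the plain transpose is the adjoint and
  annihilators involve no conjugation.\<close>

lemma cdot_matrix: "cdot a (A *v y) = cdot (transpose A *v a) y"
  by (simp add: cdot_def matrix_vector_mult_def transpose_def sum_distrib_left sum_distrib_right mult_ac)
    (rule sum.swap)

lemma cdot_eq_0_imp_eq_0:
  assumes "\<And>y. cdot a y = 0"
  shows "a = 0"
proof -
  have "a $ i = 0" for i
    using assms[of "axis i 1"] by (simp add: cdot_def axis_def if_distrib[of "(*) c" for c] cong: if_cong)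
  then show ?thesis by (simp add: vec_eq_iff)
qed

text \<open>A - \<mu> is singular, hence so is its transpose. The resulting covector vanishes on
  every eigenvector of A whose eigenvalue is not \<mu>, which makes it a detector for
  weights.\<close>

lemma left_eigenvector_exists:
  fixes A :: "complex^'d^'d"
  assumes "x \<noteq> 0" "A *v x = \<mu> *s x"
  shows "\<exists>a. a \<noteq> 0 \<and> (\<forall>y. cdot a (A *v y) = \<mu> * cdot a y)"
proof -
  let ?A = "A - mat \<mu>"
  have "?A *v x = 0" using assms(2) by (simp add: matrix_vector_mult_diff_rdistrib mat_mult_vec)
  then have "\<nexists>B. B ** ?A = mat 1"
    using assms(1) matrix_left_invertible_ker by blast
  then have "\<nexists>B. B ** transpose ?A = mat 1"
    by (metis matrix_left_right_inverse matrix_transpose_mul transpose_mat transpose_transpose)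
  then obtain a where a: "a \<noteq> 0" "transpose ?A *v a = 0"
    using matrix_left_invertible_ker by blast
  have "cdot a (A *v y) = \<mu> * cdot a y" for y
  proof -
    have "cdot a (?A *v y) = 0" unfolding cdot_matrix a(2) by (simp add: cdot_def)
    then have "cdot a (A *v y + (- \<mu>) *s y) = 0"
      by (simp add: matrix_vector_mult_diff_rdistrib mat_mult_vec)
    then show ?thesis unfolding cdot_add cdot_smult by simp
  qed
  with a show ?thesis by blast
qed

inductive_set lowering_words ::
  "nat \<Rightarrow> (nat \<Rightarrow> nat \<Rightarrow> complex^'d^'d) \<Rightarrow> complex^'d \<Rightarrow> (complex^'d) set"
  for N rho v where
  base: "v \<in> lowering_words N rho v"
| step: "y \<in> lowering_words N rho v \<Longrightarrow> p \<in> {1..N} \<Longrightarrow> q \<in> {1..N} \<Longrightarrow> q \<le> p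
    \<Longrightarrow> rho p q *v y \<in> lowering_words N rho v"

text \<open>The linear span is taken as a double annihilator, so that a left eigenvector can be
  tested on the words alone.\<close>

definition ann_span :: "(complex^'d) set \<Rightarrow> (complex^'d) set" where
  "ann_span X = {y. \<forall>a. (\<forall>x\<in>X. cdot a x = 0) \<longrightarrow> cdot a y = 0}"

lemma ann_span_superset: "X \<subseteq> ann_span X"
  by (auto simp: ann_span_def)

lemma csubspace_ann_span: "csubspace (ann_span X)"
  by (auto simp: csubspace_def ann_span_def cdot_add cdot_smult) (simp add: cdot_def)

lemma ann_span_invariant:
  assumes "\<And>x. x \<in> X \<Longrightarrow> A *v x \<in> ann_span X" "y \<in> ann_span X"
  shows "A *v y \<in> ann_span X"
  using assms unfolding ann_span_def by (auto simp: cdot_matrix)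

lemma csubspaceD:
  assumes "csubspace M"
  shows "0 \<in> M" "x \<in> M \<Longrightarrow> y \<in> M \<Longrightarrow> x + y \<in> M" "x \<in> M \<Longrightarrow> c *s x \<in> M"
    "x \<in> M \<Longrightarrow> y \<in> M \<Longrightarrow> x - y \<in> M"
proof -
  show *: "0 \<in> M" "x \<in> M \<Longrightarrow> y \<in> M \<Longrightarrow> x + y \<in> M" "x \<in> M \<Longrightarrow> c *s x \<in> M" for x y c
    using assms by (auto simp: csubspace_def)
  show "x \<in> M \<Longrightarrow> y \<in> M \<Longrightarrow> x - y \<in> M"
    using *(2)[of x "(-1) *s y"] *(3)[of y "-1"] by simp
qed

text \<open>This stands in for a PBW argument: any generator is moved past the first letter of a
  word, and every term is then a lowering operator or a bracket acting on what the shorter word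
  already covers.\<close>

lemma graded_invariant_lowering_words:
  assumes rep: "is_gl_super_rep m N rho P"
    and par: "P *v v = v \<or> P *v v = - v"
    and sing: "\<And>p q. p \<in> {1..N} \<Longrightarrow> q \<in> {1..N} \<Longrightarrow> p < q \<Longrightarrow> rho p q *v v = 0"
  shows "graded_invariant N rho P (ann_span (lowering_words N rho v))"
proof -
  let ?X = "lowering_words N rho v" let ?M = "ann_span ?X"
  note M = csubspaceD[OF csubspace_ann_span[of ?X]] and XM = subsetD[OF ann_span_superset[of ?X]]
  have low: "rho p q *v y \<in> ?M" if "p \<in> {1..N}" "q \<in> {1..N}" "q \<le> p" "y \<in> ?M" for p q y
    by (rule ann_span_invariant[OF _ that(4)]) (use that lowering_words.step XM in blast)
  have X: "rho r s *v x \<in> ?M" if "x \<in> ?X" "r \<in> {1..N}" "s \<in> {1..N}" for r s x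
    using that
  proof (induction arbitrary: r s rule: lowering_words.induct)
    case base
    then show ?case
      using sing[of r s] M(1) low[of r s v] XM[OF lowering_words.base] by (cases "r < s") auto
  next
    case (step y p q)
    show ?case
      unfolding rep_bracket[OF rep step.prems step.hyps(2,3)]
      by (intro M low step) (auto intro!: step M)
  qed
  have P: "P *v x \<in> ?M" if "x \<in> ?X" for x
    using that
  proof (induction rule: lowering_words.induct)
    case base
    have "v \<in> ?M" by (rule XM[OF lowering_words.base])
    then show ?case using par M(3)[of v "-1"] by auto
  next
    case (step y p q)
    show ?case
      unfolding rep_parity[OF rep step.hyps(2,3)] by (intro M low step)
  qed
  show ?thesis
    unfolding graded_invariant_def
    using csubspace_ann_span[of ?X] X P ann_span_invariant[of ?X] by blast
qed

text \<open>Weights are tested through E_11 + ... + E_jj because a lowering operator changes the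
  eigenvalue of each such sum by 0 or -1, never upwards.\<close>

lemma partial_sum_weight:
  assumes rep: "is_gl_super_rep m N rho P" and j: "j \<le> N" and pq: "p \<in> {1..N}" "q \<in> {1..N}"
  shows "(\<Sum>a\<in>{1..j}. rho a a) *v (rho p q *v y)
    = rho p q *v ((\<Sum>a\<in>{1..j}. rho a a) *v y) + (of_bool (p \<le> j) - of_bool (q \<le> j)) *s (rho p q *v y)"
proof -
  have sum_v: "(\<Sum>a\<in>A. f a) *v z = (\<Sum>a\<in>A. f a *v z)" for A and f :: "nat \<Rightarrow> complex^'a^'a" and z
    by (induction A rule: infinite_finite_induct) (simp_all add: matrix_vector_mult_add_rdistrib)
  have v_sum: "B *v (\<Sum>a\<in>A. f a) = (\<Sum>a\<in>A. B *v f a)" for A B and f :: "nat \<Rightarrow> complex^'a"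
    by (induction A rule: infinite_finite_induct) (simp_all add: matrix_vector_right_distrib)
  have "(\<Sum>a\<in>{1..j}. rho a a) *v (rho p q *v y) = (\<Sum>a\<in>{1..j}. rho p q *v (rho a a *v y)
      + (if a = p then rho p q *v y else 0) - (if a = q then rho p q *v y else 0))"
    unfolding sum_v
  proof (rule sum.cong[OF refl])
    fix a assume "a \<in> {1..j}"
    then have a: "a \<in> {1..N}" using j by auto
    have "psign ((par m a + par m a) * (par m p + par m q)) = 1"
      by (simp add: psign_def power_mult mult_2[symmetric])
    then show "rho a a *v (rho p q *v y) = rho p q *v (rho a a *v y)
      + (if a = p then rho p q *v y else 0) - (if a = q then rho p q *v y else 0)"
      using rep_bracket[OF rep a a pq, of y] by auto
  qed
  also have "\<dots> = rho p q *v ((\<Sum>a\<in>{1..j}. rho a a) *v y)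
      + ((if p \<le> j then rho p q *v y else 0) - (if q \<le> j then rho p q *v y else 0))"
    using pq unfolding sum_v v_sum by (simp add: sum.distrib sum_subtractf)
  also have "(if p \<le> j then rho p q *v y else 0) - (if q \<le> j then rho p q *v y else 0)
      = (of_bool (p \<le> j) - of_bool (q \<le> j)) *s (rho p q *v y)"
    by simp
  finally show ?thesis .
qed

text \<open>By irreducibility the lowering words of v span the space, and on each word the partial
  sum has eigenvalue \<kappa> minus a natural number. A left eigenvector for any other \<mu> would
  kill all words and so be zero.\<close>

lemma singular_vector_dominates:
  assumes rep: "is_gl_super_rep m N rho P"
    and irr: "\<And>U. graded_invariant N rho P U \<Longrightarrow> U = {0} \<or> U = UNIV"
    and v: "v \<noteq> 0" "P *v v = v \<or> P *v v = - v"
    and sing: "\<And>p q. p \<in> {1..N} \<Longrightarrow> q \<in> {1..N} \<Longrightarrow> p < q \<Longrightarrow> rho p q *v v = 0"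
    and j: "j \<le> N" and ev: "(\<Sum>a\<in>{1..j}. rho a a) *v v = \<kappa> *s v"
    and x: "x \<noteq> 0" "(\<Sum>a\<in>{1..j}. rho a a) *v x = \<mu> *s x"
  shows "\<exists>k::nat. \<mu> = \<kappa> - of_nat k"
proof (rule ccontr)
  assume *: "\<nexists>k::nat. \<mu> = \<kappa> - of_nat k"
  let ?X = "lowering_words N rho v" let ?e = "\<Sum>a\<in>{1..j}. rho a a"
  obtain a where a: "a \<noteq> 0" "\<And>y. cdot a (?e *v y) = \<mu> * cdot a y"
    using left_eigenvector_exists[OF x] by blast
  have "v \<in> ann_span ?X" using ann_span_superset lowering_words.base by blast
  then have univ: "ann_span ?X = UNIV"
    using irr[OF graded_invariant_lowering_words[OF rep v(2) sing]] v(1) by blast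
  have weights: "\<exists>k::nat. ?e *v y = (\<kappa> - of_nat k) *s y" if "y \<in> ?X" for y
    using that
  proof induction
    case base
    show ?case using ev by (intro exI[of _ 0]) simp
  next
    case (step y p q)
    then obtain k :: nat where k: "?e *v y = (\<kappa> - of_nat k) *s y" by blast
    obtain d :: nat where d: "of_bool (p \<le> j) - of_bool (q \<le> j) = - (of_nat d :: complex)"
    proof (cases "p \<le> j \<or> \<not> q \<le> j")
      case True
      then show ?thesis using that[of 0] step(4) by auto
    next
      case False
      then show ?thesis using that[of 1] by auto
    qed
    have "?e *v (rho p q *v y) = (\<kappa> - of_nat (k + d)) *s (rho p q *v y)"
      unfolding partial_sum_weight[OF rep j step(2,3)] k d
      by (simp add: vector_scalar_commute vec_eq_iff algebra_simps)
    then show ?case by blast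
  qed
  have "cdot a y = 0" if y: "y \<in> ?X" for y
  proof -
    obtain k :: nat where k: "?e *v y = (\<kappa> - of_nat k) *s y" using weights[OF y] by blast
    have "\<mu> * cdot a y = (\<kappa> - of_nat k) * cdot a y"
      unfolding a(2)[symmetric] k cdot_smult ..
    then show ?thesis using * by auto
  qed
  then have "cdot a y = 0" for y
    using univ unfolding ann_span_def by blast
  then show False using cdot_eq_0_imp_eq_0 a(1) by blast
qed


lemma partial_sum_eigenvalue:
  fixes rho :: "nat \<Rightarrow> nat \<Rightarrow> complex^'d^'d"
  assumes "\<And>a. a \<in> {1..j} \<Longrightarrow> rho a a *v x = f a *s x"
  shows "(\<Sum>a\<in>{1..j}. rho a a) *v x = (\<Sum>a\<in>{1..j}. f a) *s x"
  using assms by (induction j) (simp_all add: matrix_vector_mult_add_rdistrib vector_sadd_rdistrib)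

text \<open>Each singular vector dominates the other, so all partial sums agree, and with them their
  differences. Only the first L weights are compared, since in the application x need not be known
  to be an eigenvector of E_NN.\<close>

lemma singular_weight_unique:
  assumes rep: "is_gl_super_rep m N rho P"
    and irr: "\<And>U. graded_invariant N rho P U \<Longrightarrow> U = {0} \<or> U = UNIV"
    and v: "v \<noteq> 0" "P *v v = v \<or> P *v v = - v"
      "\<And>p q. p \<in> {1..N} \<Longrightarrow> q \<in> {1..N} \<Longrightarrow> p < q \<Longrightarrow> rho p q *v v = 0"
    and x: "x \<noteq> 0" "P *v x = x \<or> P *v x = - x"
      "\<And>p q. p \<in> {1..N} \<Longrightarrow> q \<in> {1..N} \<Longrightarrow> p < q \<Longrightarrow> rho p q *v x = 0"
    and L: "L \<le> N" "\<And>a. a \<in> {1..L} \<Longrightarrow> rho a a *v v = f a *s v"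
      "\<And>a. a \<in> {1..L} \<Longrightarrow> rho a a *v x = g a *s x"
    and i: "i \<in> {1..L}"
  shows "f i = g i"
proof -
  have eq: "(\<Sum>a\<in>{1..j}. f a) = (\<Sum>a\<in>{1..j}. g a)" if j: "j \<le> L" for j
  proof -
    have jN: "j \<le> N" using j L(1) by simp
    have ev: "(\<Sum>a\<in>{1..j}. rho a a) *v v = (\<Sum>a\<in>{1..j}. f a) *s v"
      "(\<Sum>a\<in>{1..j}. rho a a) *v x = (\<Sum>a\<in>{1..j}. g a) *s x"
      by (rule partial_sum_eigenvalue; use j L in auto)+
    obtain k where k: "(\<Sum>a\<in>{1..j}. g a) = (\<Sum>a\<in>{1..j}. f a) - of_nat k"
      using singular_vector_dominates[OF rep irr v jN ev(1) x(1) ev(2)] by auto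
    obtain k' where k': "(\<Sum>a\<in>{1..j}. f a) = (\<Sum>a\<in>{1..j}. g a) - of_nat k'"
      using singular_vector_dominates[OF rep irr x jN ev(2) v(1) ev(1)] by auto
    have "of_nat k = (\<Sum>a\<in>{1..j}. f a) - (\<Sum>a\<in>{1..j}. g a)"
      using k by (simp add: algebra_simps)
    moreover have "of_nat k' = (\<Sum>a\<in>{1..j}. g a) - (\<Sum>a\<in>{1..j}. f a)"
      using k' by (simp add: algebra_simps)
    ultimately have "(of_nat (k + k') :: complex) = 0" by simp
    then have "k = 0" by (metis add_is_0 of_nat_eq_0_iff)
    then show ?thesis using k by simp
  qed
  obtain i' where i': "i = Suc i'" using i by (cases i) auto
  show ?thesis using eq[of i] eq[of i'] i unfolding i' by simp
qed

text \<open>Among the words in the \<open>E\<^sub>p\<^sub>N\<close> that do not annihilate \<open>w\<close>, one of maximal length and, for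
  that length, of minimal index sum yields a singular vector of the larger algebra. Its weight
  differs from that of \<open>w\<close> by the letter counts, and an odd letter occurs at most once.\<close>

lemma branching_weights:
  fixes rho :: "nat \<Rightarrow> nat \<Rightarrow> complex^'d^'d"
  assumes rep: "is_gl_super_rep m N rho P" and N: "N = Suc L" "m \<le> L"
    and V: "irred_hw_module N rho P UNIV LamT"
    and w: "w \<noteq> 0" "P *v w = w \<or> P *v w = - w"
      "\<And>p. p \<in> {1..L} \<Longrightarrow> rho p p *v w = Lam p *s w"
      "\<And>p q. p \<in> {1..L} \<Longrightarrow> q \<in> {1..L} \<Longrightarrow> p < q \<Longrightarrow> rho p q *v w = 0"
    and i: "i \<in> {1..m}"
  shows "LamT i = Lam i \<or> LamT i = Lam i + 1"
proof -
  define act where "act = (\<lambda>xs y. foldr (\<lambda>p z. rho p N *v z) xs y)"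
  have act_Nil: "act [] y = y" and act_Cons: "act (p # xs) y = rho p N *v act xs y"
    and act_append: "act (xs @ ys) y = act xs (act ys y)" for p xs ys y
    by (simp_all add: act_def)
  have act_linear: "act xs 0 = 0" "act xs (y + z) = act xs y + act xs z"
    "act xs (c *s y) = c *s act xs y" for xs y z c
    by (induction xs) (simp_all add: act_Nil act_Cons matrix_vector_right_distrib vector_scalar_commute)
  have NI: "N \<in> {1..N}" and LN: "\<And>p. p \<in> {1..L} \<Longrightarrow> p \<in> {1..N}" "\<And>p. p \<in> {1..L} \<Longrightarrow> p \<noteq> N"
    using N by auto
  have weight: "rho a a *v act xs w = (Lam a + of_nat (count_list xs a)) *s act xs w"
    if a: "a \<in> {1..L}" and xs: "set xs \<subseteq> {1..L}" for a xs
    using xs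
  proof (induction xs)
    case Nil
    then show ?case using w(3)[OF a] by (simp add: act_Nil)
  next
    case (Cons x xs)
    have x: "x \<in> {1..L}" using Cons.prems by simp
    have "psign ((par m a + par m a) * (par m x + par m N)) = 1"
      by (simp add: psign_def power_mult mult_2[symmetric])
    then have "rho a a *v (rho x N *v act xs w) = rho x N *v (rho a a *v act xs w)
        + (if a = x then rho x N *v act xs w else 0)"
      using rep_bracket[OF rep LN(1)[OF a] LN(1)[OF a] LN(1)[OF x] NI, of "act xs w"] LN(2)[OF a] by auto
    moreover have "rho x N *v (rho a a *v act xs w) = (Lam a + of_nat (count_list xs a)) *s (rho x N *v act xs w)"
      using Cons by (simp add: vector_scalar_commute matrix_vector_right_distrib)
    ultimately have "rho a a *v (rho x N *v act xs w) = (Lam a + of_nat (count_list xs a)) *s (rho x N *v act xs w)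
        + (if a = x then rho x N *v act xs w else 0)" by simp
    then show ?case
      by (auto simp: act_Cons vec_eq_iff algebra_simps)
  qed
  have parity: "P *v act xs w = act xs w \<or> P *v act xs w = - act xs w" if "set xs \<subseteq> {1..L}" for xs
    using that
  proof (induction xs)
    case Nil
    then show ?case using w(2) by (simp add: act_Nil)
  next
    case (Cons x xs)
    have x: "x \<in> {1..N}" using Cons.prems LN by simp
    have s: "psign k = 1 \<or> psign k = -1" for k by (induction k) (auto simp: psign_def)
    have "rho x N *v (- z) = - (rho x N *v z)" for z
      using vector_scalar_commute[of "rho x N" "-1" z] by simp
    then show ?case
      using Cons s[of "par m x + par m N"]
      by (auto simp: act_Cons rep_parity[OF rep x NI])
  qed
  define Good where "Good xs \<longleftrightarrow> set xs \<subseteq> {1..L} \<and> act xs w \<noteq> 0" for xs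
  \<comment> \<open>E_11 + ... + E_LL has on such a word an eigenvalue that grows with the length,
    while a bounded operator bounds its eigenvalues.\<close>
  have bounded: "\<exists>b. \<forall>xs. Good xs \<longrightarrow> length xs \<le> b"
  proof -
    let ?e = "\<Sum>a\<in>{1..L}. rho a a" and ?l = "\<Sum>a\<in>{1..L}. Lam a"
    obtain K where K: "\<And>x. norm (?e *v x) \<le> norm x * K"
      using bounded_linear.bounded[OF matrix_vector_mul_bounded_linear[of ?e]] by blast
    have "length xs \<le> nat \<lceil>K + norm ?l\<rceil>" if g: "Good xs" for xs
    proof -
      have "?e *v act xs w = (\<Sum>a\<in>{1..L}. Lam a + of_nat (count_list xs a)) *s act xs w"
        by (rule partial_sum_eigenvalue) (use g weight in \<open>auto simp: Good_def\<close>)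
      also have "(\<Sum>a\<in>{1..L}. Lam a + of_nat (count_list xs a)) = ?l + of_nat (length xs)"
        using g sum_count_set[of xs "{1..L}"] by (simp add: sum.distrib Good_def flip: of_nat_sum)
      finally have le: "norm ((?l + of_nat (length xs)) *s act xs w) \<le> norm (act xs w) * K"
        using K[of "act xs w"] by simp
      have norm_s: "norm (c *s z) = norm c * norm z" for c and z :: "complex^'d"
        by (simp add: norm_vec_def L2_set_def norm_mult power_mult_distrib sum_distrib_left[symmetric]
            real_sqrt_mult)
      have "norm (?l + of_nat (length xs)) * norm (act xs w) \<le> K * norm (act xs w)"
        using le unfolding norm_s by (simp only: mult.commute)
      then have "norm (?l + of_nat (length xs)) \<le> K"
        using g by (simp add: Good_def)
      moreover have "norm (of_nat (length xs) :: complex) \<le> norm (?l + of_nat (length xs)) + norm ?l"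
        by (metis add_diff_cancel_left' norm_triangle_ineq4)
      ultimately have "real (length xs) \<le> K + norm ?l" by simp
      then show ?thesis by linarith
    qed
    then show ?thesis by blast
  qed
  have "Good []" using w(1) by (simp add: Good_def act_Nil)
  obtain b where "\<forall>xs. Good xs \<longrightarrow> length xs < b" using bounded less_Suc_eq_le by metis
  from ex_has_greatest_nat[OF \<open>Good []\<close> this]
  obtain ys where ys: "Good ys" "\<And>zs. Good zs \<Longrightarrow> length zs \<le> length ys" by blast
  obtain xs where xs: "Good xs" "length xs = length ys"
    "\<And>zs. Good zs \<Longrightarrow> length zs = length ys \<Longrightarrow> sum_list xs \<le> sum_list zs"
    using ex_has_least_nat[of "\<lambda>zs. Good zs \<and> length zs = length ys" ys sum_list] ys(1) by auto
  have xsL: "set xs \<subseteq> {1..L}" using xs(1) by (simp add: Good_def)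
  \<comment> \<open>Passing E_pq with p < q through a letter E_qN replaces that letter by E_pN and
    lowers the index sum, so by minimality the new word annihilates w.\<close>
  have raise: "act zs (rho p q *v act ts w) = 0"
    if pq: "p \<in> {1..L}" "q \<in> {1..L}" "p < q" and "zs @ ts = xs" for p q zs ts
    using that(4)
  proof (induction ts arbitrary: zs)
    case Nil
    then show ?case using w(4)[OF pq] by (simp add: act_Nil act_linear)
  next
    case (Cons x ts)
    have x: "x \<in> {1..L}" using Cons.prems xsL by auto
    let ?g = "psign ((par m p + par m q) * (par m x + par m N))"
    have "act zs (rho p q *v act (x # ts) w)
        = ?g *s act (zs @ [x]) (rho p q *v act ts w) + (if q = x then act (zs @ p # ts) w else 0)"
      using rep_bracket[OF rep LN(1)[OF pq(1)] LN(1)[OF pq(2)] LN(1)[OF x] NI, of "act ts w"] LN(2)[OF pq(1)]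
      by (simp add: act_linear act_Cons act_append act_Nil)
    also have "act (zs @ [x]) (rho p q *v act ts w) = 0"
      using Cons.IH[of "zs @ [x]"] Cons.prems by simp
    also have "(if q = x then act (zs @ p # ts) w else 0) = 0"
    proof (cases "q = x")
      case True
      have "\<not> Good (zs @ p # ts)"
      proof
        assume g: "Good (zs @ p # ts)"
        have "length (zs @ p # ts) = length ys"
          using xs(2) Cons.prems by auto
        then have "sum_list xs \<le> sum_list (zs @ p # ts)"
          by (rule xs(3)[OF g])
        then show False using Cons.prems True pq(3) by auto
      qed
      then show ?thesis using Cons.prems xsL pq(1) by (auto simp: Good_def)
    qed simp
    finally show ?case by simp
  qed
  have top: "rho p N *v act xs w = 0" if "p \<in> {1..L}" for p
  proof (rule ccontr)
    assume "rho p N *v act xs w \<noteq> 0"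
    then have "Good (p # xs)" using that xsL by (simp add: Good_def act_Cons)
    from ys(2)[OF this] xs(2) show False by simp
  qed
  have sing: "rho p q *v act xs w = 0" if "p \<in> {1..N}" "q \<in> {1..N}" "p < q" for p q
  proof (cases "q = N")
    case True
    then show ?thesis using top[of p] that N by auto
  next
    case False
    then show ?thesis using raise[of p q "[]" xs] that N by (auto simp: act_Nil)
  qed
  obtain v where v: "v \<noteq> 0" "P *v v = v \<or> P *v v = - v"
    "\<And>p. p \<in> {1..N} \<Longrightarrow> rho p p *v v = LamT p *s v"
    "\<And>p q. p \<in> {1..N} \<Longrightarrow> q \<in> {1..N} \<Longrightarrow> p < q \<Longrightarrow> rho p q *v v = 0"
    using V unfolding irred_hw_module_def by auto
  have irr: "U = {0} \<or> U = UNIV" if "graded_invariant N rho P U" for U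
    using V that unfolding irred_hw_module_def by auto
  have eq: "LamT i = Lam i + of_nat (count_list xs i)"
  proof (rule singular_weight_unique[OF rep irr v(1,2,4), where x = "act xs w" and L = L
        and i = i and f = LamT and g = "\<lambda>a. Lam a + of_nat (count_list xs a)"])
    show "act xs w \<noteq> 0" using xs(1) by (simp add: Good_def)
  qed (use v(3) sing parity weight xsL N i in auto)
  \<comment> \<open>As i is even and N odd, E_iN squares to zero; up to sign it commutes with the
    other letters, so it can travel to an earlier copy of itself.\<close>
  have absorb: "rho i N *v act ts w = 0" if "i \<in> set ts" "set ts \<subseteq> {1..L}" for ts
    using that
  proof (induction ts)
    case (Cons x ts)
    have iI: "i \<in> {1..N}" "i \<noteq> N" and x: "x \<in> {1..N}" "x \<noteq> N"
      using i N Cons.prems by auto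
    show ?case
    proof (cases "x = i")
      case True
      have "rho i N *v (rho i N *v act ts w) = - (rho i N *v (rho i N *v act ts w))"
        using rep_bracket[OF rep iI(1) NI iI(1) NI, of "act ts w"] iI(2) i N
        by (simp add: psign_def par_def)
      then have "2 *s (rho i N *v (rho i N *v act ts w)) = 0"
        by (metis add.right_inverse one_add_one vector_sadd_rdistrib vector_smult_lid)
      then show ?thesis using True by (simp add: act_Cons)
    next
      case False
      then have "rho i N *v act ts w = 0" using Cons by auto
      then show ?thesis
        using rep_bracket[OF rep iI(1) NI x(1) NI, of "act ts w"] iI(2) x(2) by (simp add: act_Cons)
    qed
  qed simp
  have "count_list ts i \<le> 1" if "act ts w \<noteq> 0" "set ts \<subseteq> {1..L}" for ts
    using that
  proof (induction ts)
    case (Cons x ts)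
    have "act ts w \<noteq> 0" using Cons.prems by (auto simp: act_Cons)
    then show ?case
      using Cons absorb[of ts] by (auto simp: act_Cons count_list_0_iff)
  qed simp
  then have "count_list xs i \<le> 1" using xs(1) xsL by (auto simp: Good_def)
  then have "count_list xs i = 0 \<or> count_list xs i = 1" by linarith
  then show ?thesis using eq by auto
qed

section \<open>Solving the difference equation\<close>

lemma tendsto_smult:
  fixes x :: "'b \<Rightarrow> complex^'d"
  assumes "(c \<longlongrightarrow> c0) F" "(x \<longlongrightarrow> x0) F"
  shows "((\<lambda>t. c t *s x t) \<longlongrightarrow> c0 *s x0) F"
  by (rule vec_tendstoI) (auto intro!: tendsto_intros assms simp: vector_smult_component)

text \<open>The quotient of x by \<gamma> has period 1, which leaves a periodic ambiguity; its limit
  w at infinity, taken along u + k, removes it.\<close>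

lemma difference_equation_solution:
  fixes x :: "real \<Rightarrow> complex^'d" and \<gamma> f g :: "real \<Rightarrow> complex"
  assumes xeq: "\<And>u. u0 \<le> u \<Longrightarrow> f u *s x (u + 1) = g u *s x u"
    and geq: "\<And>u. u0 \<le> u \<Longrightarrow> f u * \<gamma> (u + 1) = g u * \<gamma> u"
    and nz: "\<And>u. u0 \<le> u \<Longrightarrow> f u \<noteq> 0" "\<And>u. u0 \<le> u \<Longrightarrow> \<gamma> u \<noteq> 0"
    and xlim: "((\<lambda>u. u *\<^sub>R x u) \<longlongrightarrow> w) at_top"
    and glim: "((\<lambda>u. of_real u * \<gamma> u) \<longlongrightarrow> 1) at_top"
    and u: "u0 \<le> u"
  shows "x u = \<gamma> u *s w"
proof -
  define y where "y t = (1 / \<gamma> t) *s x t" for t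
  have step: "y (t + 1) = y t" if t: "u0 \<le> t" for t
  proof -
    have t1: "u0 \<le> t + 1" using t by simp
    have gn: "g t \<noteq> 0" using geq[OF t] nz(1)[OF t] nz(2)[OF t1] by auto
    have "x (t + 1) = (1 / f t) *s (f t *s x (t + 1))"
      using nz(1)[OF t] by (simp add: vector_smult_assoc)
    also have "\<dots> = (g t / f t) *s x t"
      unfolding xeq[OF t] by (simp add: vector_smult_assoc)
    finally have x1: "x (t + 1) = (g t / f t) *s x t" .
    have "\<gamma> (t + 1) = g t / f t * \<gamma> t"
      using geq[OF t] nz(1)[OF t] by (simp add: field_simps)
    then show ?thesis
      unfolding y_def x1 using gn nz(1)[OF t] by (simp add: vector_smult_assoc)
  qed
  have const: "y (u + real k) = y u" for k
  proof (induction k)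
    case (Suc k)
    have "y (u + real (Suc k)) = y ((u + real k) + 1)" by (simp add: add_ac)
    also have "\<dots> = y u" using step[of "u + real k"] u Suc by simp
    finally show ?case .
  qed simp
  have "((\<lambda>t. (1 / (of_real t * \<gamma> t)) *s (t *\<^sub>R x t)) \<longlongrightarrow> (1 / 1) *s w) at_top"
    by (intro tendsto_smult tendsto_divide tendsto_const xlim glim) simp
  moreover have "\<forall>\<^sub>F t in at_top. (1 / (of_real t * \<gamma> t)) *s (t *\<^sub>R x t) = y t"
    using eventually_gt_at_top[of 0]
    by eventually_elim (simp add: y_def scaleR_conv_smult vector_smult_assoc)
  ultimately have "(y \<longlongrightarrow> w) at_top"
    by (simp add: Lim_transform_eventually)
  moreover have "filterlim (\<lambda>k. u + real k) at_top sequentially"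
    by (rule filterlim_tendsto_add_at_top[OF tendsto_const filterlim_real_sequentially])
  ultimately have "(\<lambda>k. y (u + real k)) \<longlonglongrightarrow> w"
    by (rule filterlim_compose)
  then have "y u = w" unfolding const by (simp add: LIMSEQ_const_iff)
  then show ?thesis using nz(2)[OF u] by (auto simp: y_def vector_smult_assoc)
qed

text \<open>Lagrange interpolation: after clearing denominators both sides have degree below
  \<open>card A\<close> and agree at the \<open>card A\<close> distinct nodes.\<close>

lemma partial_fractions:
  fixes a b :: "nat \<Rightarrow> complex"
  assumes "finite A" "finite B" "card B < card A" "inj_on b A" "z \<notin> b ` A"
  shows "(\<Prod>r\<in>B. z - a r) / (\<Prod>k\<in>A. z - b k)
    = (\<Sum>s\<in>A. (\<Prod>k\<in>A - {s}. 1 / (b s - b k)) * (\<Prod>r\<in>B. b s - a r) / (z - b s))"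
proof -
  define c where "c s = (\<Prod>k\<in>A - {s}. 1 / (b s - b k)) * (\<Prod>r\<in>B. b s - a r)" for s
  define p where "p = (\<Prod>r\<in>B. [:- a r, 1:])"
  define q where "q = (\<Sum>s\<in>A. smult (c s) (\<Prod>k\<in>A - {s}. [:- b k, 1:]))"
  have ne: "A \<noteq> {}" using assms(3) by auto
  have evp: "poly p x = (\<Prod>r\<in>B. x - a r)" for x
    by (simp add: p_def poly_prod)
  have evq: "poly q x = (\<Sum>s\<in>A. c s * (\<Prod>k\<in>A - {s}. x - b k))" for x
    by (simp add: q_def poly_sum poly_prod)
  have "p = q"
  proof (rule poly_eqI_degree[where A = "b ` A"])
    fix x assume "x \<in> b ` A"
    then obtain t where t: "t \<in> A" "x = b t" by auto
    have "poly q x = (\<Sum>s\<in>A. if s = t then c t * (\<Prod>k\<in>A - {t}. b t - b k) else 0)"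
      unfolding evq t(2) by (intro sum.cong refl) (use assms(1) t(1) in auto)
    also have "\<dots> = c t * (\<Prod>k\<in>A - {t}. b t - b k)"
      using assms(1) t(1) by simp
    also have "\<dots> = (\<Prod>r\<in>B. b t - a r) * (\<Prod>k\<in>A - {t}. 1 / (b t - b k) * (b t - b k))"
      unfolding c_def prod.distrib by (simp only: mult_ac)
    also have "(\<Prod>k\<in>A - {t}. 1 / (b t - b k) * (b t - b k)) = 1"
      by (rule prod.neutral) (use inj_onD[OF assms(4)] t(1) in auto)
    finally show "poly p x = poly q x" by (simp add: evp t(2))
  next
    have "degree p \<le> card B"
      unfolding p_def using degree_prod_sum_le[OF assms(2), of "\<lambda>r. [:- a r, 1:]"] by simp
    then show "card (b ` A) > degree p" using assms(3) card_image[OF assms(4)] by simp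
    have "degree q \<le> card A - 1"
      unfolding q_def
    proof (rule degree_sum_le[OF assms(1)])
      fix s assume s: "s \<in> A"
      have "degree (\<Prod>k\<in>A - {s}. [:- b k, 1:]) \<le> card (A - {s})"
        using degree_prod_sum_le[of "A - {s}" "\<lambda>r. [:- b r, 1:]"] assms(1) by simp
      then show "degree (smult (c s) (\<Prod>k\<in>A - {s}. [:- b k, 1:])) \<le> card A - 1"
        using s assms(1) degree_smult_le[of "c s"] le_trans by fastforce
    qed
    moreover have "card A > 0" using ne assms(1) by (simp add: card_gt_0_iff)
    ultimately show "card (b ` A) > degree q" using card_image[OF assms(4)] by simp
  qed
  then have "(\<Prod>r\<in>B. z - a r) = (\<Sum>s\<in>A. c s * (\<Prod>k\<in>A - {s}. z - b k))"
    using evp evq by metis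
  moreover have "c s * (\<Prod>k\<in>A - {s}. z - b k) / (\<Prod>k\<in>A. z - b k) = c s / (z - b s)" if s: "s \<in> A" for s
  proof -
    have "(\<Prod>k\<in>A - {s}. z - b k) \<noteq> 0" using assms(1,5) by auto
    then show ?thesis by (simp add: prod.remove[OF assms(1) s])
  qed
  ultimately show ?thesis
    by (simp add: sum_divide_distrib c_def)
qed

section \<open>Reading moments off an expansion at infinity\<close>

lemma geom_bounded_mono:
  assumes "geom_bounded C M D" "0 \<le> C" "M \<le> M'"
  shows "geom_bounded C M' D"
  unfolding geom_bounded_def
proof (intro conjI allI)
  show "0 \<le> M'" using assms by (auto simp: geom_bounded_def)
  fix k
  have "norm (D k) \<le> C * M ^ k" using assms by (auto simp: geom_bounded_def)
  also have "\<dots> \<le> C * M' ^ k"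
    by (intro mult_left_mono power_mono) (use assms in \<open>auto simp: geom_bounded_def\<close>)
  finally show "norm (D k) \<le> C * M' ^ k" .
qed

lemma geom_bounded_powers: "geom_bounded 1 (norm b) (\<lambda>k. (b :: complex) ^ k)"
  by (simp add: geom_bounded_def norm_power)

lemma gseries_powers:
  assumes "norm b < u"
  shows "gseries (\<lambda>k. (b :: complex) ^ k) u = 1 / (of_real u - b)"
proof -
  let ?S = "gseries (\<lambda>k. b ^ k) u"
  have "of_real u * ?S = 1 + gseries (\<lambda>k. b * b ^ k) u"
    using gseries_shift[OF geom_bounded_powers assms] by (simp add: scaleR_conv_of_real)
  also have "gseries (\<lambda>k. b * b ^ k) u = b * ?S"
    by (rule gseries_bounded_linear[OF bounded_linear_mult_right geom_bounded_powers assms, symmetric])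
  finally have "(of_real u - b) * ?S = 1" by (simp add: algebra_simps)
  then show ?thesis by (metis mult_zero_left nonzero_eq_divide_eq mult.commute zero_neq_one)
qed

lemma gseries_moments:
  fixes D :: "nat \<Rightarrow> complex^'d" and b c :: "nat \<Rightarrow> complex"
  assumes D: "geom_bounded C M D" and A: "finite A"
    and eq: "\<forall>\<^sub>F u in at_top. gseries D u = (\<Sum>s\<in>A. c s / (of_real u - b s)) *s w"
  shows "D k = (\<Sum>s\<in>A. c s * b s ^ k) *s w"
proof -
  define M' where "M' = M + (\<Sum>s\<in>A. norm (b s))"
  \<comment> \<open>The negated summand of the expected moments, so that adding it to
    \<open>D\<close> must give a vanishing series; \<open>M'\<close> is large enough for all the
    poles at once.\<close>
  define f where "f s z = (- (c s * z)) *s w" for s z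
  have M0: "0 \<le> M" using D by (simp add: geom_bounded_def)
  have bM: "norm (b s) \<le> M'" if "s \<in> A" for s
  proof -
    have "norm (b s) \<le> (\<Sum>s\<in>A. norm (b s))" by (rule member_le_sum) (use A that in auto)
    then show ?thesis using M0 by (simp add: M'_def)
  qed
  have lin: "bounded_linear (f s)" for s
    unfolding linear_conv_bounded_linear[symmetric]
    by (rule linearI) (simp_all add: f_def vec_eq_iff algebra_simps scaleR_conv_of_real[where 'a=complex])
  have C0: "0 \<le> C" using D[unfolded geom_bounded_def, THEN conjunct2, rule_format, of 0]
    by (simp add: order_trans[OF norm_ge_zero])
  have g1: "geom_bounded C M' D"
    by (rule geom_bounded_mono[OF D C0]) (simp add: M'_def sum_nonneg)
  have g2: "geom_bounded 1 M' (\<lambda>k. b s ^ k)" if "s \<in> A" for s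
    by (rule geom_bounded_mono[OF geom_bounded_powers _ bM[OF that]]) simp
  have g3: "\<exists>C. geom_bounded C M' (\<lambda>k. f s (b s ^ k))" if "s \<in> A" for s
    by (rule geom_bounded_bounded_linear[OF lin g2[OF that]])
  have "\<exists>C. geom_bounded C M' (\<lambda>k. \<Sum>s\<in>A'. f s (b s ^ k))" if "A' \<subseteq> A" for A'
    using finite_subset[OF that A] that
  proof (induction A')
    case empty
    show ?case by (rule exI[of _ 0]) (use M0 in \<open>simp add: geom_bounded_def M'_def sum_nonneg\<close>)
  next
    case (insert s A')
    then show ?case using geom_bounded_add g3[of s] by fastforce
  qed
  then obtain C' where g4: "geom_bounded C' M' (\<lambda>k. \<Sum>s\<in>A. f s (b s ^ k))" by blast
  have "\<forall>\<^sub>F u in at_top. gseries (\<lambda>k. D k + (\<Sum>s\<in>A. f s (b s ^ k))) u = 0"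
    using eq eventually_gt_at_top[of M']
  proof eventually_elim
    case (elim u)
    have "gseries (\<lambda>k. \<Sum>s\<in>A. f s (b s ^ k)) u = (\<Sum>s\<in>A. gseries (\<lambda>k. f s (b s ^ k)) u)"
      by (rule gseries_sum[OF A g3 elim(2)])
    also have "\<dots> = (\<Sum>s\<in>A. f s (1 / (of_real u - b s)))"
    proof (rule sum.cong[OF refl])
      fix s assume s: "s \<in> A"
      have "norm (b s) < u" using bM[OF s] elim(2) by simp
      then show "gseries (\<lambda>k. f s (b s ^ k)) u = f s (1 / (of_real u - b s))"
        using gseries_bounded_linear[OF lin g2[OF s] elim(2), of s] by (simp add: gseries_powers)
    qed
    also have "\<dots> = - (gseries D u)"
      unfolding elim(1) by (simp add: f_def vec.scale_sum_left sum_negf)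
    finally show ?case using gseries_add[OF g1 g4 elim(2)] by simp
  qed
  then have "D k + (\<Sum>s\<in>A. f s (b s ^ k)) = 0"
    by (rule gseries_zero_imp_coeffs_zero[OF geom_bounded_add[OF g1 g4]])
  then show ?thesis
    by (simp add: f_def vec.scale_sum_left sum_negf)
qed

section \<open>Commuting operators\<close>

lemma mat_endo_mat_commute: "mat_endo (mat c) * mat_endo A = mat_endo A * mat_endo (mat c)"
  by (rule endo_eqI) (simp add: mat_mult_vec vector_scalar_commute)

lemma mat_endo_real_scale: "mat_endo (mat (of_real r) ** A) = r *\<^sub>R mat_endo A"
  by (rule endo_eqI)
    (simp add: mat_mult_vec matrix_vector_mul_assoc[symmetric] app.scaleR_left scaleR_conv_smult)

lemma psign_of_real: "psign k = of_real ((-1) ^ k)"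
  by (simp add: psign_def)

lemma gl_super_of_rep:
  assumes "is_gl_super_rep m N rho P"
  shows "gl_super m N (\<lambda>p q. mat_endo (rho p q))"
proof (rule gl_super.intro)
  fix p q r s assume I: "p \<in> {1..N}" "q \<in> {1..N}" "r \<in> {1..N}" "s \<in> {1..N}"
  show "mat_endo (rho p q) * mat_endo (rho r s) = sg m p q r s *\<^sub>R (mat_endo (rho r s) * mat_endo (rho p q))
      + of_bool (q = r) *\<^sub>R mat_endo (rho p s) - (sg m p q r s * of_bool (p = s)) *\<^sub>R mat_endo (rho r q)"
    by (rule endo_eqI, unfold app_mult app_mat_endo rep_bracket[OF assms I])
      (auto simp: app.add_left app.diff_left app.scaleR_left scaleR_conv_smult sg_def psign_of_real)
qed

lemma B_eq_Bmat:
  assumes "is_gl_super_rep m N rho P"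
  shows "gl_super.B m (\<lambda>p q. mat_endo (rho p q)) = (\<lambda>p q. mat_endo (Bmat m rho p q))"
  by (intro ext)
    (simp add: gl_super.B_def[OF gl_super_of_rep[OF assms]] Bmat_def psign_of_real mat_endo_real_scale
      eps_def del: of_real_power)

lemma mat_endo_opmat_pow: "mat_endo (opmat_pow N X k p q) = mpow N (\<lambda>p q. mat_endo (X p q)) k p q"
  by (induction k arbitrary: p q) (simp_all add: opmat_mult_def mat_endo_sum mat_endo_mult mat_endo_one mat_endo_zero)

lemma parity_mpow:
  fixes Q :: "'a::real_algebra_1"
  assumes "\<And>p q. p \<in> {1..N} \<Longrightarrow> q \<in> {1..N} \<Longrightarrow> Q * X p q = (e p * e q) *\<^sub>R (X p q * Q)"
    and e: "\<And>p. e p * e p = 1" and "p \<in> {1..N}" "q \<in> {1..N}"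
  shows "Q * mpow N X k p q = (e p * e q) *\<^sub>R (mpow N X k p q * Q)"
  using assms(3,4)
proof (induction k arbitrary: p)
  case 0
  then show ?case by (simp add: e)
next
  case (Suc k)
  have "Q * (X p r * mpow N X k r q) = (e p * e q) *\<^sub>R (X p r * mpow N X k r q * Q)" if r: "r \<in> {1..N}" for r
  proof -
    have "Q * (X p r * mpow N X k r q) = (Q * X p r) * mpow N X k r q" by (simp only: mult.assoc)
    also have "\<dots> = (e p * e r) *\<^sub>R (X p r * (Q * mpow N X k r q))"
      unfolding assms(1)[OF Suc.prems(1) r] by (simp only: mult.assoc mult_scaleR_left)
    also have "\<dots> = (e p * (e r * e r) * e q) *\<^sub>R (X p r * mpow N X k r q * Q)"
      unfolding Suc.IH[OF r Suc.prems(2)] by (simp add: mult.assoc)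
    finally show ?thesis by (simp add: e)
  qed
  then show ?case by (simp add: sum_distrib_left sum_distrib_right scaleR_sum_right)
qed

lemma parity_res:
  fixes Q :: "'a::{real_normed_algebra_1,banach}"
  assumes "\<And>p q. p \<in> {1..N} \<Longrightarrow> q \<in> {1..N} \<Longrightarrow> Q * X p q = (e p * e q) *\<^sub>R (X p q * Q)"
    and e: "\<And>p. e p * e p = 1" and p: "p \<in> {1..N}" and u: "rad N X < u"
  shows "Q * res N X u p p = res N X u p p * Q"
proof -
  have "Q * mpow N X k p p = mpow N X k p p * Q" for k
    using parity_mpow[OF assms(1) e p p] by (simp add: e)
  then show ?thesis
    unfolding res_def
    using gseries_bounded_linear[OF bounded_linear_mult_right[of Q] geom_bounded_mpow[OF p p] u]
      gseries_bounded_linear[OF bounded_linear_mult_left[of Q] geom_bounded_mpow[OF p p] u]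
    by simp
qed

text \<open>Schur's lemma with the eigenvalue supplied by v: the eigenspace inside W is graded
  invariant and nonzero. T is not assumed to map W into itself.\<close>

lemma commuting_operator_scalar:
  fixes T :: "(complex^'d) endo"
  assumes inv: "graded_invariant K rho P W"
    and irr: "\<And>U. U \<subseteq> W \<Longrightarrow> graded_invariant K rho P U \<Longrightarrow> U = {0} \<or> U = W"
    and T: "\<And>p q. p \<in> {1..K} \<Longrightarrow> q \<in> {1..K} \<Longrightarrow> T * mat_endo (rho p q) = mat_endo (rho p q) * T"
      "T * mat_endo P = mat_endo P * T" "\<And>a. T * mat_endo (mat a) = mat_endo (mat a) * T"
    and v: "v \<in> W" "v \<noteq> 0" "app T v = c *s v" and x: "x \<in> W"
  shows "app T x = c *s x"
proof -
  let ?U = "{x\<in>W. app T x = c *s x}"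
  have comm: "app T (A *v y) = A *v app T y" if "T * mat_endo A = mat_endo A * T" for A y
    using arg_cong[OF that, of "\<lambda>a. app a y"] by simp
  have smult: "app T (a *s y) = a *s app T y" for a y
    using comm[OF T(3)] by (simp add: mat_mult_vec)
  have "graded_invariant K rho P ?U"
    unfolding graded_invariant_def csubspace_def
  proof (intro conjI ballI allI)
    show "0 \<in> ?U" using inv by (simp add: graded_invariant_def csubspace_def app.zero_right)
  next
    fix y z assume "y \<in> ?U" "z \<in> ?U"
    then show "y + z \<in> ?U"
      using inv by (simp add: graded_invariant_def csubspace_def app.add_right vector_add_ldistrib)
  next
    fix a y assume "y \<in> ?U"
    then show "a *s y \<in> ?U"
      using inv by (simp add: graded_invariant_def csubspace_def smult vector_smult_assoc mult.commute)
  next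
    fix y assume "y \<in> ?U"
    then show "P *v y \<in> ?U"
      using inv by (simp add: graded_invariant_def comm[OF T(2)] vector_scalar_commute)
  next
    fix p q y assume "p \<in> {1..K}" "q \<in> {1..K}" "y \<in> ?U"
    then show "rho p q *v y \<in> ?U"
      using inv comm[OF T(1)] by (simp add: graded_invariant_def vector_scalar_commute)
  qed
  then have "?U = {0} \<or> ?U = W" by (intro irr) auto
  moreover have "v \<in> ?U" using v by simp
  ultimately show ?thesis using v(2) x by auto
qed

lemma rep_parity_endo:
  assumes "is_gl_super_rep m N rho P" "p \<in> {1..N}" "q \<in> {1..N}"
  shows "mat_endo P * mat_endo (Bmat m rho p q)
    = (eps m p * eps m q) *\<^sub>R (mat_endo (Bmat m rho p q) * mat_endo P)"
  by (rule endo_eqI)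
    (simp add: app.scaleR_left scaleR_conv_smult Bmat_def matrix_vector_mul_assoc[symmetric] mat_mult_vec
      vector_scalar_commute rep_parity[OF assms] vector_smult_assoc eps_def psign_def power_add mult_ac)

lemma mpow_corner_commute:
  fixes k :: nat
  assumes rep: "is_gl_super_rep m N rho P" and N: "N = Suc L"
  defines "c \<equiv> mpow N (\<lambda>p q. mat_endo (Bmat m rho p q)) k N N"
  shows "p \<in> {1..L} \<Longrightarrow> q \<in> {1..L} \<Longrightarrow> c * mat_endo (rho p q) = mat_endo (rho p q) * c"
    and "c * mat_endo P = mat_endo P * c" and "c * mat_endo (mat a) = mat_endo (mat a) * c"
proof -
  interpret gl: gl_super m N "\<lambda>p q. mat_endo (rho p q)" by (rule gl_super_of_rep[OF rep])
  have NI: "N \<in> {1..N}" using N by simp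
  have c: "c = mpow N gl.B k N N" unfolding c_def B_eq_Bmat[OF rep] ..
  show "c * mat_endo (rho p q) = mat_endo (rho p q) * c" if "p \<in> {1..L}" "q \<in> {1..L}" for p q
  proof -
    have "mat_endo (rho p q) * gl.G k N N = gl.G k N N * mat_endo (rho p q)"
      by (subst gl.G_covariant) (use that N in auto)
    then show ?thesis by (simp add: gl.G_def c eps_def)
  qed
  show "c * mat_endo P = mat_endo P * c"
  proof -
    have "mat_endo P * c = (eps m N * eps m N) *\<^sub>R (c * mat_endo P)"
      unfolding c_def by (rule parity_mpow[where e = "eps m"]) (use rep_parity_endo[OF rep] NI in auto)
    then show ?thesis by simp
  qed
  show "c * mat_endo (mat a) = mat_endo (mat a) * c"
    unfolding c_def by (rule commute_mpow[OF _ NI NI, symmetric]) (rule mat_endo_mat_commute)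
qed

lemma mat_endo_opmat_poly:
  "mat_endo (opmat_poly N f X p q)
    = (\<Sum>k\<le>degree f. mat_endo (mat (coeff f k)) * mpow N (\<lambda>p q. mat_endo (X p q)) k p q)"
  by (simp add: opmat_poly_def mat_endo_sum mat_endo_mult mat_endo_opmat_pow)

lemma opmat_poly_corner_commute:
  fixes f :: "complex poly"
  assumes rep: "is_gl_super_rep m N rho P" and N: "N = Suc L"
  defines "c \<equiv> mat_endo (opmat_poly N f (Bmat m rho) N N)"
  shows "p \<in> {1..L} \<Longrightarrow> q \<in> {1..L} \<Longrightarrow> c * mat_endo (rho p q) = mat_endo (rho p q) * c"
    and "c * mat_endo P = mat_endo P * c" and "c * mat_endo (mat a) = mat_endo (mat a) * c"
proof -
  have *: "c * mat_endo A = mat_endo A * c"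
    if "\<And>k. mpow N (\<lambda>p q. mat_endo (Bmat m rho p q)) k N N * mat_endo A
      = mat_endo A * mpow N (\<lambda>p q. mat_endo (Bmat m rho p q)) k N N" for A
    unfolding c_def mat_endo_opmat_poly sum_distrib_left sum_distrib_right mult.assoc that
    by (simp only: mult.assoc[symmetric] mat_endo_mat_commute)
  show "p \<in> {1..L} \<Longrightarrow> q \<in> {1..L} \<Longrightarrow> c * mat_endo (rho p q) = mat_endo (rho p q) * c"
    "c * mat_endo P = mat_endo P * c" "c * mat_endo (mat a) = mat_endo (mat a) * c"
    by (rule *, rule mpow_corner_commute[OF rep N]; assumption)+
qed

lemma eventually_of_real_neq: "\<forall>\<^sub>F u in at_top. complex_of_real u \<noteq> z"
  using eventually_gt_at_top[of "norm z"]
  by eventually_elim (metis abs_ge_self norm_of_real not_less)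

section \<open>Eigenvalues of the corner projections\<close>

lemma tendsto_linear_ratio:
  fixes a b :: complex
  shows "((\<lambda>u. (of_real u - a) / (of_real u - b)) \<longlongrightarrow> 1) at_top"
proof -
  have inv: "((\<lambda>u. 1 / (complex_of_real u - b)) \<longlongrightarrow> 0) at_top"
  proof (rule tendsto_divide_0[OF tendsto_const])
    have "filterlim (\<lambda>u. norm (complex_of_real u - b)) at_top at_top"
    proof (rule filterlim_at_top_mono)
      show "filterlim (\<lambda>u::real. - norm b + u) at_top at_top"
        by (rule filterlim_tendsto_add_at_top[OF tendsto_const filterlim_ident])
      show "\<forall>\<^sub>F u in at_top. - norm b + u \<le> norm (complex_of_real u - b)"
      proof (rule always_eventually, rule allI)
        fix u :: real
        have "u \<le> norm (complex_of_real u)" by simp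
        also have "\<dots> \<le> norm (complex_of_real u - b) + norm b"
          by (metis diff_add_cancel norm_triangle_ineq)
        finally show "- norm b + u \<le> norm (complex_of_real u - b)" by simp
      qed
    qed
    then show "filterlim (\<lambda>u. complex_of_real u - b) at_infinity at_top"
      by (rule filterlim_norm_at_top_imp_at_infinity)
  qed
  have "((\<lambda>u. 1 + (b - a) * (1 / (complex_of_real u - b))) \<longlongrightarrow> 1 + (b - a) * 0) at_top"
    by (intro tendsto_intros inv)
  moreover have "\<forall>\<^sub>F u in at_top. 1 + (b - a) * (1 / (complex_of_real u - b)) = (of_real u - a) / (of_real u - b)"
    using eventually_of_real_neq[of b] by eventually_elim (simp add: field_simps)
  ultimately show ?thesis by (simp add: Lim_transform_eventually)
qed

text \<open>The value on one singular vector is not enough: in the difference equation \<tau>(u) is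
  applied to c(u + 1) w, a vector not yet known to be a multiple of w.\<close>

lemma tau_scalar:
  fixes rho :: "nat \<Rightarrow> nat \<Rightarrow> complex^'d^'d" and rk :: "nat \<Rightarrow> int"
  assumes rep: "is_gl_super_rep m N rho P"
    and irr: "\<And>U. graded_invariant N rho P U \<Longrightarrow> U = {0} \<or> U = UNIV"
    and rk: "inj_on rk {1..N}"
    and v: "v \<noteq> 0" "\<And>p q. p \<in> {1..N} \<Longrightarrow> q \<in> {1..N} \<Longrightarrow> rk p < rk q \<Longrightarrow> rho p q *v v = 0"
      "\<And>p. p \<in> {1..N} \<Longrightarrow> rho p p *v v = lam p *s v"
    and b: "\<And>p. p \<in> {1..N} \<Longrightarrow>
      b p = of_real (eps m p) * lam p + (\<Sum>t\<in>{t\<in>{1..N}. rk p < rk t}. of_real (eps m t))"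
    and u: "rad N (\<lambda>p q. mat_endo (Bmat m rho p q)) < u" and ub: "\<And>p. p \<in> {1..N} \<Longrightarrow> of_real u \<noteq> b p"
  shows "x - app (gl_super.tau m N (\<lambda>p q. mat_endo (rho p q)) u) x
    = (\<Prod>p\<in>{1..N}. (of_real u - b p - of_real (eps m p)) / (of_real u - b p)) *s x"
proof -
  interpret gl: gl_super m N "\<lambda>p q. mat_endo (rho p q)" by (rule gl_super_of_rep[OF rep])
  let ?F = "\<Prod>p\<in>{1..N}. (of_real u - b p - of_real (eps m p)) / (of_real u - b p)"
  have u': "rad N gl.B < u" using u unfolding B_eq_Bmat[OF rep] .
  have Fv: "v - app (gl.tau u) v = ?F *s v"
  proof (rule tau_singular_vector[OF gl.gl_super_axioms _ rk _ _ b u' ub])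
    show "mat_endo (mat c) * mat_endo (rho p q) = mat_endo (rho p q) * mat_endo (mat c)" for p q c
      by (rule mat_endo_mat_commute)
  qed (use v in auto)
  have "app (gl.tau u) v = v - (v - app (gl.tau u) v)" by simp
  then have tv: "app (gl.tau u) v = (1 - ?F) *s v"
    unfolding Fv by (simp add: vec.scale_left_diff_distrib)
  have res_comm: "Z * gl.tau u = gl.tau u * Z"
    if "\<And>p. p \<in> {1..N} \<Longrightarrow> Z * res N gl.B u p p = res N gl.B u p p * Z" for Z
    unfolding gl.tau_def gl.GR_def sum_distrib_left sum_distrib_right
    by (intro sum.cong refl) (simp add: that)
  have "app (gl.tau u) x = (1 - ?F) *s x"
  proof (rule commuting_operator_scalar[where K = N and rho = rho and P = P and W = UNIV])
    show "graded_invariant N rho P UNIV" by (simp add: graded_invariant_def csubspace_def)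
    show "U = {0} \<or> U = UNIV" if "graded_invariant N rho P U" for U by (rule irr[OF that])
    show "gl.tau u * mat_endo (rho p q) = mat_endo (rho p q) * gl.tau u" if "p \<in> {1..N}" "q \<in> {1..N}" for p q
      by (rule gl.tau_central[OF that u'])
    show "gl.tau u * mat_endo P = mat_endo P * gl.tau u"
    proof (rule res_comm[symmetric])
      fix p assume "p \<in> {1..N}"
      then show "mat_endo P * res N gl.B u p p = res N gl.B u p p * mat_endo P"
        unfolding B_eq_Bmat[OF rep]
        by (intro parity_res[where e = "eps m"]) (use rep_parity_endo[OF rep] u in auto)
    qed
    show "gl.tau u * mat_endo (mat a) = mat_endo (mat a) * gl.tau u" for a
    proof (rule res_comm[symmetric])
      fix p assume p: "p \<in> {1..N}"
      show "mat_endo (mat a) * res N gl.B u p p = res N gl.B u p p * mat_endo (mat a)"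
        by (rule commute_res[OF gl.commute_B u' p p]) (auto intro: mat_endo_mat_commute)
    qed
  qed (use v tv in auto)
  then show ?thesis by (simp add: vec.scale_left_diff_distrib)
qed

text \<open>The eigenvalue \<open>\<gamma>\<close> solves the difference equation obtained from \<open>res_corner_difference_equation\<close>;
  its poles cancel down to the index set \<open>I\<close> because of \<open>branch\<close>.\<close>

lemma corner_projection_eigenvalue:
  fixes rho :: "nat \<Rightarrow> nat \<Rightarrow> complex^'d^'d" and rk :: "nat \<Rightarrow> int" and a b :: "nat \<Rightarrow> complex"
  assumes rep: "is_gl_super_rep m N rho P" and N: "N = Suc L" "m \<le> L"
    and irrV: "\<And>U. graded_invariant N rho P U \<Longrightarrow> U = {0} \<or> U = UNIV"
    and invW: "graded_invariant L rho P W"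
    and irrW: "\<And>U. U \<subseteq> W \<Longrightarrow> graded_invariant L rho P U \<Longrightarrow> U = {0} \<or> U = W"
    and rk: "inj_on rk {1..N}"
    and v: "v \<noteq> 0" "\<And>p q. p \<in> {1..N} \<Longrightarrow> q \<in> {1..N} \<Longrightarrow> rk p < rk q \<Longrightarrow> rho p q *v v = 0"
      "\<And>p. p \<in> {1..N} \<Longrightarrow> rho p p *v v = lamT p *s v"
    and w: "w \<in> W" "w \<noteq> 0" "\<And>p q. p \<in> {1..L} \<Longrightarrow> q \<in> {1..L} \<Longrightarrow> rk p < rk q \<Longrightarrow> rho p q *v w = 0"
      "\<And>p. p \<in> {1..L} \<Longrightarrow> rho p p *v w = lam p *s w"
    and b: "\<And>p. p \<in> {1..N} \<Longrightarrow>
      b p = of_real (eps m p) * lamT p + (\<Sum>t\<in>{t\<in>{1..N}. rk p < rk t}. of_real (eps m t))"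
    and a: "\<And>p. p \<in> {1..L} \<Longrightarrow>
      a p = of_real (eps m p) * lam p + (\<Sum>t\<in>{t\<in>{1..L}. rk p < rk t}. of_real (eps m t))"
    and inj: "inj_on b {1..N}"
    and branch: "\<And>i. i \<in> {1..m} \<Longrightarrow> a i = b i \<or> a i = b i + 1"
    and I: "I = {i\<in>{1..m}. a i = b i} \<union> {m+1..L}"
    and s: "s \<in> {1..N}" and x: "x \<in> W"
  shows "opmat_poly N (proj_poly N b s) (Bmat m rho) N N *v x
    = (if s \<in> I \<union> {N} then (\<Prod>k\<in>I \<union> {N} - {s}. 1 / (b s - b k)) * (\<Prod>r\<in>I. b s - a r - psign (par m r))
       else 0) *s x"
proof -
  define X where "X = (\<lambda>p q. mat_endo (Bmat m rho p q))"
  interpret gl: gl_super m N "\<lambda>p q. mat_endo (rho p q)" by (rule gl_super_of_rep[OF rep])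
  interpret sub: gl_super m L "\<lambda>p q. mat_endo (rho p q)"
    by (rule gl_super_mono[OF gl.gl_super_axioms]) (simp add: N)
  have BX: "gl.B = X" unfolding X_def by (rule B_eq_Bmat[OF rep])
  have LN: "p \<in> {1..N}" if "p \<in> {1..L}" for p using that N by simp
  have NI: "N \<in> {1..N}" using N by simp
  have rkL: "inj_on rk {1..L}" using rk by (rule inj_on_subset) (use N in auto)
  let ?e = "\<lambda>p. complex_of_real (eps m p)"
  define F where "F u = (\<Prod>p\<in>{1..N}. (of_real u - b p - ?e p) / (of_real u - b p))" for u
  define F' where "F' u = (\<Prod>p\<in>{1..L}. (of_real u - a p - ?e p) / (of_real u - a p))" for u
  \<comment> \<open>Each \<open>g p\<close> solves the factor of the difference equation that
    belongs to p: its numerator and denominator telescope under u to u + 1 against the factors with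
    b p and a p. The two cases reflect the sign of p.\<close>
  define g where "g p u = (if p \<le> m then (of_real u - (b p + 1)) / (of_real u - a p)
      else (of_real u - (a p - 1)) / (of_real u - b p))" for p u
  define \<gamma> where "\<gamma> u = (\<Prod>p\<in>{1..L}. g p u) / (of_real u - b N)" for u
  \<comment> \<open>Only finitely many points can be zeros or poles of the factors at u and u + 1,
    so one \<open>u0\<close> lies beyond them all.\<close>
  have "\<forall>\<^sub>F u in at_top. rad N X < u \<and> (\<forall>p\<in>{1..N}. \<forall>z\<in>{b p, b p + 1, b p - 1, a p, a p - 1, a p - 2}.
      complex_of_real u \<noteq> z)"
    by (intro eventually_conj eventually_gt_at_top eventually_ball_finite ballI eventually_of_real_neq) auto
  then obtain u0 where u0: "\<And>u. u0 \<le> u \<Longrightarrow> rad N X < u"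
    "\<And>u p z. u0 \<le> u \<Longrightarrow> p \<in> {1..N} \<Longrightarrow> z \<in> {b p, b p + 1, b p - 1, a p, a p - 1, a p - 2}
      \<Longrightarrow> complex_of_real u \<noteq> z"
    unfolding eventually_at_top_linorder by blast
  have ne: "complex_of_real u - b p \<noteq> 0" "complex_of_real u - b p - 1 \<noteq> 0" "complex_of_real u - b p + 1 \<noteq> 0"
    "complex_of_real u - a p \<noteq> 0" "complex_of_real u - a p + 1 \<noteq> 0" "complex_of_real u - a p + 2 \<noteq> 0"
    if "u0 \<le> u" "p \<in> {1..N}" for u p
    using u0(2)[OF that, of "b p"] u0(2)[OF that, of "b p + 1"] u0(2)[OF that, of "b p - 1"]
      u0(2)[OF that, of "a p"] u0(2)[OF that, of "a p - 1"] u0(2)[OF that, of "a p - 2"]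
    by (auto simp: algebra_simps)
  have ep: "?e p = (if p \<le> m then 1 else -1)" for p by (simp add: eps_def par_def)
  have splitN: "prod f {1..N} = prod f {1..L} * f N" for f :: "nat \<Rightarrow> complex"
    using N(1) by simp
  have F_nz: "F u \<noteq> 0" if u: "u0 \<le> u" for u
  proof -
    have "(of_real u - b p - ?e p) / (of_real u - b p) \<noteq> 0" if "p \<in> {1..N}" for p
      using ne(1-3)[OF u that] by (auto simp: ep)
    then show ?thesis unfolding F_def by simp
  qed
  have \<gamma>_nz: "\<gamma> u \<noteq> 0" if u: "u0 \<le> u" for u
  proof -
    have "g p u \<noteq> 0" if "p \<in> {1..L}" for p
      using ne[OF u LN[OF that]] by (auto simp: g_def algebra_simps)
    then show ?thesis unfolding \<gamma>_def using ne(1)[OF u NI] by simp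
  qed
  have \<gamma>_eq: "F u * \<gamma> (u + 1) = F' (u + 1) * \<gamma> u" if u: "u0 \<le> u" for u
  proof -
    let ?z = "complex_of_real u"
    have "(?z - b p - ?e p) / (?z - b p) * g p (u + 1) = (?z + 1 - a p - ?e p) / (?z + 1 - a p) * g p u"
      if p: "p \<in> {1..L}" for p
    proof -
      note n = ne[OF u LN[OF p]]
      have n': "?z + 1 - a p \<noteq> 0" "?z + 1 - b p \<noteq> 0" using n(3,5) by (simp_all add: algebra_simps)
      show ?thesis
      proof (cases "p \<le> m")
        case True
        have "(?z - b p - 1) / (?z - b p) * ((?z + 1 - (b p + 1)) / (?z + 1 - a p))
            = (?z + 1 - a p - 1) / (?z + 1 - a p) * ((?z - (b p + 1)) / (?z - a p))"
          using n n' by (simp add: divide_simps; simp add: algebra_simps)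
        then show ?thesis using True by (simp add: g_def ep)
      next
        case False
        have "(?z - b p + 1) / (?z - b p) * ((?z + 1 - (a p - 1)) / (?z + 1 - b p))
            = (?z + 1 - a p + 1) / (?z + 1 - a p) * ((?z - (a p - 1)) / (?z - b p))"
          using n n' by (simp add: divide_simps; simp add: algebra_simps)
        then show ?thesis using False by (simp add: g_def ep)
      qed
    qed
    then have prods: "(\<Prod>p\<in>{1..L}. (?z - b p - ?e p) / (?z - b p)) * (\<Prod>p\<in>{1..L}. g p (u + 1))
      = F' (u + 1) * (\<Prod>p\<in>{1..L}. g p u)"
      unfolding F'_def prod.distrib[symmetric] by (intro prod.cong refl) simp
    have "?e N = -1" using N by (simp add: ep)
    moreover have "?z + 1 - b N \<noteq> 0" using ne(3)[OF u NI] by (simp add: algebra_simps)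
    \<comment> \<open>The index N has no partner in the smaller algebra. Its factor is absorbed by 1
      / (u - b N), which also gives \<gamma> the required decay 1 / u.\<close>
    ultimately have last: "(?z - b N - ?e N) / (?z - b N) / (?z + 1 - b N) = 1 / (?z - b N)"
      using ne(1)[OF u NI] by (simp add: divide_simps)
    have "F u * \<gamma> (u + 1) = ((\<Prod>p\<in>{1..L}. (?z - b p - ?e p) / (?z - b p)) * (\<Prod>p\<in>{1..L}. g p (u + 1)))
        * ((?z - b N - ?e N) / (?z - b N) / (?z + 1 - b N))"
      unfolding F_def splitN \<gamma>_def by simp
    also have "\<dots> = F' (u + 1) * \<gamma> u"
      unfolding prods last \<gamma>_def by simp
    finally show ?thesis .
  qed
  have \<gamma>_lim: "((\<lambda>u. of_real u * \<gamma> u) \<longlongrightarrow> 1) at_top"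
  proof -
    have "((\<lambda>u. g p u) \<longlongrightarrow> 1) at_top" for p
      unfolding g_def by (cases "p \<le> m") (use tendsto_linear_ratio in \<open>simp_all only: if_True if_False\<close>)
    then have "((\<lambda>u. (\<Prod>p\<in>{1..L}. g p u) * ((of_real u - 0) / (of_real u - b N))) \<longlongrightarrow> (\<Prod>p\<in>{1..L}. 1) * 1) at_top"
      by (intro tendsto_mult tendsto_prod tendsto_linear_ratio)
    then show ?thesis by (simp add: \<gamma>_def mult_ac)
  qed
  define D where "D k = app (mpow N X k N N) w" for k
  define y where "y u = app (res N X u N N) w" for u
  obtain C where gD: "geom_bounded C (rad N X) D"
    unfolding D_def using geom_bounded_bounded_linear[OF app.bounded_linear_left geom_bounded_mpow[OF NI NI]] by blast
  have yD: "y u = gseries D u" if "rad N X < u" for u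
    unfolding y_def D_def res_def
    by (rule gseries_bounded_linear[OF app.bounded_linear_left geom_bounded_mpow[OF NI NI] that])
  have ylim: "((\<lambda>u. u *\<^sub>R y u) \<longlongrightarrow> w) at_top"
  proof (rule Lim_transform_eventually)
    show "((\<lambda>u. u *\<^sub>R gseries D u) \<longlongrightarrow> w) at_top"
      using gseries_limit[OF gD] by (simp add: D_def)
    show "\<forall>\<^sub>F u in at_top. u *\<^sub>R gseries D u = u *\<^sub>R y u"
      using eventually_gt_at_top[of "rad N X"] by eventually_elim (simp add: yD)
  qed
  have yeq: "F u *s y (u + 1) = F' (u + 1) *s y u" if u: "u0 \<le> u" for u
  proof -
    have uX: "rad N X < u" by (rule u0(1)[OF u])
    have u1: "u0 \<le> u + 1" using u by simp
    have LX: "rad L X < u + 1" using rad_mono[of L N X] N uX by simp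
    have "F u *s y (u + 1) = y (u + 1) - app (gl.tau u) (y (u + 1))"
      unfolding F_def
      by (rule tau_scalar[OF rep irrV rk v b, symmetric]) (use uX u0(2)[OF u] in \<open>auto simp: X_def\<close>)
    also have "\<dots> = app ((1 - gl.tau u) * res N X (u + 1) N N) w"
      by (simp add: y_def app.diff_left)
    also have "\<dots> = app (res N X u N N) (w - app (sub.tau (u + 1)) w)"
      using gl.res_corner_difference_equation[OF N] uX unfolding BX
      by (simp add: app.diff_left)
    also have "w - app (sub.tau (u + 1)) w = F' (u + 1) *s w"
      unfolding F'_def
    proof (rule tau_singular_vector[OF sub.gl_super_axioms _ rkL _ _ a])
      show "mat_endo (mat c) * mat_endo (rho p q) = mat_endo (rho p q) * mat_endo (mat c)" for p q c
        by (rule mat_endo_mat_commute)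
      show "complex_of_real (u + 1) \<noteq> a p" if "p \<in> {1..L}" for p
        by (rule u0(2)[OF u1 LN[OF that]]) simp
    qed (use w LX in \<open>auto simp: BX\<close>)
    also have "app (res N X u N N) (F' (u + 1) *s w) = F' (u + 1) *s y u"
      unfolding y_def
      by (rule app_res_smult[OF _ uX NI NI]) (simp add: X_def mat_endo_mat_commute)
    finally show ?thesis .
  qed
  have yg: "y u = \<gamma> u *s w" if "u0 \<le> u" for u
    by (rule difference_equation_solution[where f = F and g = "\<lambda>u. F' (u + 1)", OF yeq \<gamma>_eq F_nz \<gamma>_nz ylim \<gamma>_lim that])
  let ?A = "I \<union> {N}"
  have fin: "finite I" "I \<subseteq> {1..L}" "N \<notin> I" using I N by auto
  have AN: "?A \<subseteq> {1..N}" using fin(2) N by auto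
  have injA: "inj_on b ?A" using inj AN by (rule inj_on_subset)
  have par_e: "psign (par m r) = ?e r" for r by (simp add: eps_def psign_def)
  define c where "c s = (\<Prod>k\<in>?A - {s}. 1 / (b s - b k)) * (\<Prod>r\<in>I. b s - (a r + ?e r))" for s
  have \<gamma>_pf: "\<gamma> u = (\<Sum>s\<in>?A. c s / (of_real u - b s))" if u: "u0 \<le> u" for u
  proof -
    let ?z = "complex_of_real u"
    have "(\<Prod>p\<in>{1..L}. g p u) = (\<Prod>p\<in>I. (?z - (a p + ?e p)) / (?z - b p))"
    proof (rule prod.mono_neutral_cong_right)
      \<comment> \<open>Outside \<open>I\<close> branching leaves only a p = b p + 1, where
        numerator and denominator coincide; so b p is not a pole.\<close>
      show "\<forall>p\<in>{1..L} - I. g p u = 1"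
      proof
        fix p assume p: "p \<in> {1..L} - I"
        then have "p \<le> m" "a p = b p + 1" using branch[of p] I by auto
        moreover have "?z - (b p + 1) \<noteq> 0"
          using ne(2)[OF u LN, of p] p by (simp add: algebra_simps)
        ultimately show "g p u = 1" by (simp add: g_def)
      qed
      show "g p u = (?z - (a p + ?e p)) / (?z - b p)" if "p \<in> I" for p
        using that I by (auto simp: g_def ep)
    qed (use fin in auto)
    then have "\<gamma> u = (\<Prod>r\<in>I. ?z - (a r + ?e r)) / (\<Prod>k\<in>?A. ?z - b k)"
      unfolding \<gamma>_def using fin by (simp add: prod_dividef mult_ac)
    also have "\<dots> = (\<Sum>s\<in>?A. c s / (?z - b s))"
      unfolding c_def
    proof (rule partial_fractions)
      show "?z \<notin> b ` ?A"
      proof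
        assume "?z \<in> b ` ?A"
        then obtain t where t: "t \<in> ?A" "?z = b t" by blast
        then show False using u0(2)[OF u subsetD[OF AN t(1)], of "b t"] by simp
      qed
    qed (use fin injA in auto)
    finally show ?thesis .
  qed
  have moments: "D k = (\<Sum>s\<in>?A. c s * b s ^ k) *s w" for k
  proof (rule gseries_moments[OF gD])
    show "\<forall>\<^sub>F u in at_top. gseries D u = (\<Sum>s\<in>?A. c s / (of_real u - b s)) *s w"
      using eventually_ge_at_top[of u0]
    proof eventually_elim
      case (elim u)
      then show ?case using yg[OF elim] yD[OF u0(1)[OF elim]] \<gamma>_pf[OF elim] by simp
    qed
  qed (use fin in auto)
  let ?f = "proj_poly N b s" and ?T = "mat_endo (opmat_poly N (proj_poly N b s) (Bmat m rho) N N)"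
  have pf: "poly ?f (b t) = of_bool (t = s)" if t: "t \<in> {1..N}" for t
  proof (cases "t = s")
    case True
    have "poly ?f (b s) = (\<Prod>k\<in>{1..N} - {s}. 1)"
      unfolding proj_poly_def poly_prod
    proof (rule prod.cong[OF refl])
      fix k assume "k \<in> {1..N} - {s}"
      then have "b s - b k \<noteq> 0" using inj_onD[OF inj, of s k] s by auto
      then show "poly (smult (1 / (b s - b k)) [:- b k, 1:]) (b s) = 1"
        by (simp add: diff_divide_distrib[symmetric])
    qed
    then show ?thesis using True by simp
  next
    case False
    then have "\<exists>k\<in>{1..N} - {s}. poly (smult (1 / (b s - b k)) [:- b k, 1:]) (b t) = 0"
      by (intro bexI[of _ t]) (use t in auto)
    then show ?thesis unfolding proj_poly_def poly_prod using False by simp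
  qed
  \<comment> \<open>By the moments, a polynomial in the matrix acts at the corner through its values
    at the nodes b t, and this polynomial is 1 at b s and 0 at the other nodes.\<close>
  have "app ?T w = (\<Sum>k\<le>degree ?f. coeff ?f k *s D k)"
    by (simp add: mat_endo_opmat_poly app.sum_left mat_mult_vec D_def X_def)
  also have "\<dots> = (\<Sum>k\<le>degree ?f. coeff ?f k * (\<Sum>t\<in>?A. c t * b t ^ k)) *s w"
    unfolding moments vector_smult_assoc by (rule vec.scale_sum_left[symmetric])
  also have "(\<Sum>k\<le>degree ?f. coeff ?f k * (\<Sum>t\<in>?A. c t * b t ^ k)) = (\<Sum>t\<in>?A. c t * poly ?f (b t))"
    unfolding poly_altdef sum_distrib_left by (subst sum.swap) (simp add: mult_ac)
  also have "\<dots> = (\<Sum>t\<in>?A. if t = s then c s else 0)"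
    by (intro sum.cong refl) (use pf AN in auto)
  also have "\<dots> = (if s \<in> ?A then c s else 0)"
    using fin(1) by simp
  finally have "app ?T w = (if s \<in> ?A then c s else 0) *s w" .
  then have "app ?T x = (if s \<in> ?A then c s else 0) *s x"
    by (intro commuting_operator_scalar[OF invW irrW opmat_poly_corner_commute[OF rep N(1)] w(1,2) _ x])
  then show ?thesis by (simp add: c_def par_e diff_diff_eq)
qed

section \<open>The barred matrices\<close>

text \<open>Minus the supertranspose: it turns \<open>Bbarmat\<close> into \<open>Bmat\<close> and highest weight vectors into
  lowest ones, which is why the eigenvalue computations allow an arbitrary order of the indices.\<close>

definition dual_rho :: "nat \<Rightarrow> (nat \<Rightarrow> nat \<Rightarrow> complex^'d^'d) \<Rightarrow> nat \<Rightarrow> nat \<Rightarrow> complex^'d^'d" where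
  "dual_rho m rho p q = - (mat (psign (par m p + par m p * par m q)) ** rho q p)"

lemma uminus_matrix_vector: "(- A) *v x = - (A *v x)" for A :: "complex^'d^'d"
  using matrix_vector_mult_diff_rdistrib[of 0 A x] by simp

lemma matrix_vector_uminus: "A *v (- x) = - (A *v x)" for A :: "complex^'d^'d"
  using vector_scalar_commute[of A "-1" x] by simp

lemma dual_rho_apply:
  "dual_rho m rho p q *v x = (- psign (par m p + par m p * par m q)) *s (rho q p *v x)"
  by (simp add: dual_rho_def uminus_matrix_vector matrix_vector_mul_assoc[symmetric] mat_mult_vec)

lemma Bbarmat_eq: "Bbarmat m rho = Bmat m (dual_rho m rho)"
proof (intro ext)
  fix p q
  show "Bbarmat m rho p q = Bmat m (dual_rho m rho) p q"
    by (subst matrix_eq)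
      (simp add: Bbarmat_def Bmat_def dual_rho_apply uminus_matrix_vector matrix_vector_mul_assoc[symmetric]
        mat_mult_vec vector_smult_assoc psign_def power_add mult.assoc[symmetric] power_mult_distrib[symmetric])
qed

lemma rho_eq_dual_rho: "rho p q = mat (- psign (par m q + par m q * par m p)) ** dual_rho m rho q p"
  by (subst matrix_eq)
    (simp add: dual_rho_apply matrix_vector_mul_assoc[symmetric] mat_mult_vec vector_smult_assoc)

lemma dual_rep:
  assumes rep: "is_gl_super_rep m N rho P"
  shows "is_gl_super_rep m N (dual_rho m rho) P"
  unfolding is_gl_super_rep_def
proof (intro conjI ballI)
  show "P ** P = mat 1" using rep by (simp add: is_gl_super_rep_def)
next
  fix p q assume pq: "p \<in> {1..N}" "q \<in> {1..N}"
  show "dual_rho m rho p q ** P = mat (psign (par m p + par m q)) ** (P ** dual_rho m rho p q)"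
    by (subst matrix_eq)
      (simp add: matrix_vector_mul_assoc[symmetric] dual_rho_apply mat_mult_vec vector_scalar_commute
        matrix_vector_uminus rep_parity[OF rep pq(2,1)] vector_smult_assoc add.commute[of "par m q"])
next
  fix p q r s assume I: "p \<in> {1..N}" "q \<in> {1..N}" "r \<in> {1..N}" "s \<in> {1..N}"
  let ?g = "psign ((par m p + par m q) * (par m r + par m s))"
  let ?a = "\<lambda>p q. psign (par m p + par m p * par m q)"
  have a1: "q = r \<Longrightarrow> ?a p q * ?a r s * ?g = ?a p s"
    and a2: "p = s \<Longrightarrow> ?a p q * ?a r s = ?g * ?a r q"
    by (auto simp: psign_def par_def)
  show "dual_rho m rho p q ** dual_rho m rho r s - mat ?g ** (dual_rho m rho r s ** dual_rho m rho p q)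
    = (if q = r then dual_rho m rho p s else 0) - mat ?g ** (if p = s then dual_rho m rho r q else 0)"
  proof (subst matrix_eq, rule allI)
    fix x
    let ?A = "rho q p" and ?B = "rho s r"
    have br: "?A *v (?B *v x) = ?g *s (?B *v (?A *v x)) + (if p = s then rho q r *v x else 0)
        - ?g *s (if q = r then rho s p *v x else 0)"
      using rep_bracket[OF rep I(2,1,4,3), of x] by (simp add: add.commute)
    have "(dual_rho m rho p q ** dual_rho m rho r s - mat ?g ** (dual_rho m rho r s ** dual_rho m rho p q)) *v x
      = (?a p q * ?a r s) *s (?A *v (?B *v x) - ?g *s (?B *v (?A *v x)))"
      by (simp add: matrix_vector_mult_diff_rdistrib matrix_vector_mul_assoc[symmetric] dual_rho_apply
          mat_mult_vec vector_scalar_commute matrix_vector_uminus vector_smult_assoc vec.scale_right_diff_distrib mult_ac)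
    also have "\<dots> = (?a p q * ?a r s) *s (if p = s then rho q r *v x else 0)
        - (?a p q * ?a r s * ?g) *s (if q = r then rho s p *v x else 0)"
      unfolding br by (simp add: vec.scale_right_diff_distrib vector_smult_assoc)
    also have "\<dots> = (if q = r then dual_rho m rho p s *v x else 0) - ?g *s (if p = s then dual_rho m rho r q *v x else 0)"
      using a1 a2 by (auto simp: dual_rho_apply vector_smult_assoc)
    also have "\<dots> = ((if q = r then dual_rho m rho p s else 0) - mat ?g ** (if p = s then dual_rho m rho r q else 0)) *v x"
      by (simp add: matrix_vector_mult_diff_rdistrib matrix_vector_mul_assoc[symmetric] mat_mult_vec)
    finally show "(dual_rho m rho p q ** dual_rho m rho r s - mat ?g ** (dual_rho m rho r s ** dual_rho m rho p q)) *v x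
      = ((if q = r then dual_rho m rho p s else 0) - mat ?g ** (if p = s then dual_rho m rho r q else 0)) *v x" .
  qed
qed

text \<open>The two families of operators agree up to nonzero scalars and transposed indices, so
  irreducibility carries over in both directions.\<close>

lemma graded_invariant_dual: "graded_invariant K (dual_rho m rho) P U \<longleftrightarrow> graded_invariant K rho P U"
proof -
  have "rho p q *v x \<in> U" if U: "csubspace U" and x: "dual_rho m rho q p *v x \<in> U" for p q x
  proof -
    have "rho p q *v x = (- psign (par m q + par m q * par m p)) *s (dual_rho m rho q p *v x)"
      by (subst rho_eq_dual_rho[of rho p q m])
        (simp add: matrix_vector_mul_assoc[symmetric] mat_mult_vec)
    then show ?thesis by (simp only: csubspaceD(3)[OF U x])
  qed
  moreover have "dual_rho m rho p q *v x \<in> U" if U: "csubspace U" and x: "rho q p *v x \<in> U" for p q x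
    unfolding dual_rho_apply by (rule csubspaceD(3)[OF U x])
  ultimately show ?thesis
    unfolding graded_invariant_def by blast
qed

section \<open>Characteristic roots as signed weights plus sums of signs\<close>

lemma sum_eps: "(\<Sum>t\<in>{1..k}. complex_of_real (eps m t)) = (if k \<le> m then of_nat k else of_nat m - of_nat (k - m))"
  by (induction k) (auto simp: eps_def par_def Suc_diff_le not_le of_nat_diff le_Suc_eq)

lemma sum_eps_above:
  assumes "p \<in> {1..K}"
  shows "(\<Sum>t\<in>{t\<in>{1..K}. int p < int t}. complex_of_real (eps m t))
    = (\<Sum>t\<in>{1..K}. of_real (eps m t)) - (\<Sum>t\<in>{1..p}. of_real (eps m t))"
proof -
  have "{1..K} = {1..p} \<union> {t\<in>{1..K}. int p < int t}" using assms by auto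
  then have "(\<Sum>t\<in>{1..K}. complex_of_real (eps m t))
      = (\<Sum>t\<in>{1..p}. of_real (eps m t)) + (\<Sum>t\<in>{t\<in>{1..K}. int p < int t}. of_real (eps m t))"
    by (metis (no_types, lifting) sum.union_disjoint[of "{1..p}" "{t\<in>{1..K}. int p < int t}"]
        disjoint_iff atLeastAtMost_iff finite_atLeastAtMost finite_Collect_conjI finite_Un mem_Collect_eq
        not_less of_nat_less_iff)
  then show ?thesis by simp
qed

lemma sum_eps_below:
  assumes "p \<in> {1..K}"
  shows "(\<Sum>t\<in>{t\<in>{1..K}. - int p < - int t}. complex_of_real (eps m t))
    = (\<Sum>t\<in>{1..p - 1}. of_real (eps m t))"
proof -
  have "{t\<in>{1..K}. - int p < - int t} = {1..p - 1}" using assms by auto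
  then show ?thesis by simp
qed

text \<open>The explicit root is put into the form demanded by the triangular recursion. The index N
  lies above all others and is odd, which explains the additional -1 in \<beta> compared with
  \<alpha>.\<close>

lemma beta_eq:
  assumes "p \<in> {1..m+n+1}"
  shows "beta m n lam p = of_real (eps m p) * lam p
    + (\<Sum>t\<in>{t\<in>{1..m+n+1}. int p < int t}. of_real (eps m t))"
  unfolding sum_eps_above[OF assms] sum_eps using assms
  by (auto simp: beta_def eps_def par_def of_nat_diff)

lemma alpha_eq:
  assumes "p \<in> {1..m+n}"
  shows "alpha m n lam p = of_real (eps m p) * lam p
    + (\<Sum>t\<in>{t\<in>{1..m+n}. int p < int t}. of_real (eps m t))"
  unfolding sum_eps_above[OF assms] sum_eps using assms
  by (auto simp: alpha_def eps_def par_def of_nat_diff)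

text \<open>In the reversed order the sum runs over the indices below p and does not depend on K.
  This is why both kinds of barred roots have one formula.\<close>

lemma bar_root_eq:
  assumes "p \<in> {1..K}"
  shows "(if p \<le> m then of_nat p - 1 - lam p else lam p + of_nat m + 1 - of_nat (p - m))
    = of_real (eps m p) * (- lam p) + (\<Sum>t\<in>{t\<in>{1..K}. - int p < - int t}. complex_of_real (eps m t))"
  unfolding sum_eps_below[OF assms] sum_eps using assms
  \<comment> \<open>At p = m + 1 the sum of signs ends at m and falls under the other case of
    \<open>sum_eps\<close>.\<close>
  by (cases "p = Suc m") (auto simp: eps_def par_def of_nat_diff)

theorem theorem3:
  fixes m n :: nat
    and rho :: "nat \<Rightarrow> nat \<Rightarrow> complex^'d^'d"
    and P :: "complex^'d^'d"
    and LamT Lam :: "nat \<Rightarrow> complex"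
    and W :: "(complex^'d) set"
  defines "N \<equiv> m + n + 1"
  assumes mn: "m \<ge> 1" "n \<ge> 1"
    and rep: "is_gl_super_rep m N rho P"
    and V_irr: "irred_hw_module N rho P UNIV LamT"
    and W_sub: "irred_hw_module (m + n) rho P W Lam"
    and gen_beta: "inj_on (beta m n LamT) {1..N}"
    and gen_betabar: "inj_on (betabar m n LamT) {1..N}"
    and gen_alpha: "inj_on (alpha m n Lam) {1..m+n}"
    and gen_alphabar: "inj_on (alphabar m n Lam) {1..m+n}"
  shows
    "(\<forall>r\<in>{1..N}. \<forall>p\<in>{1..m+n}. \<forall>q\<in>{1..m+n}.
        Qproj m n LamT rho r N N ** rho p q = rho p q ** Qproj m n LamT rho r N N \<and>
        Qbarproj m n LamT rho r N N ** rho p q = rho p q ** Qbarproj m n LamT rho r N N)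
   \<and> (\<forall>s\<in>Itil m n Lam LamT. \<forall>w\<in>W.
        Qproj m n LamT rho s N N *v w =
          ((\<Prod>k\<in>Itil m n Lam LamT - {s}. 1 / (beta m n LamT s - beta m n LamT k)) *
           (\<Prod>r\<in>Iset m n Lam LamT.
              beta m n LamT s - alpha m n Lam r - psign (par m r))) *s w)
   \<and> (\<forall>i\<in>I0bar m n Lam LamT. \<forall>w\<in>W. Qproj m n LamT rho i N N *v w = 0)
   \<and> (\<forall>s\<in>Itilprime m n Lam LamT. \<forall>w\<in>W.
        Qbarproj m n LamT rho s N N *v w =
          ((\<Prod>k\<in>Itilprime m n Lam LamT - {s}. 1 / (betabar m n LamT s - betabar m n LamT k)) *
           (\<Prod>r\<in>Iprime m n Lam LamT.
              betabar m n LamT s - alphabar m n Lam r - psign (par m r))) *s w)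
   \<and> (\<forall>i\<in>I0 m n Lam LamT. \<forall>w\<in>W. Qbarproj m n LamT rho i N N *v w = 0)"
proof -
  let ?L = "m + n" and ?d = "dual_rho m rho"
  have N: "N = Suc ?L" "m \<le> ?L" by (simp_all add: N_def)
  have drep: "is_gl_super_rep m N ?d P" by (rule dual_rep[OF rep])
  obtain v where v: "v \<noteq> 0" "\<And>p. p \<in> {1..N} \<Longrightarrow> rho p p *v v = LamT p *s v"
    "\<And>p q. p \<in> {1..N} \<Longrightarrow> q \<in> {1..N} \<Longrightarrow> p < q \<Longrightarrow> rho p q *v v = 0"
    using V_irr unfolding irred_hw_module_def by auto
  have irrV: "U = {0} \<or> U = UNIV" if "graded_invariant N rho P U" for U
    using V_irr that unfolding irred_hw_module_def by auto
  obtain w where w: "w \<in> W" "w \<noteq> 0" "P *v w = w \<or> P *v w = - w"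
    "\<And>p. p \<in> {1..?L} \<Longrightarrow> rho p p *v w = Lam p *s w"
    "\<And>p q. p \<in> {1..?L} \<Longrightarrow> q \<in> {1..?L} \<Longrightarrow> p < q \<Longrightarrow> rho p q *v w = 0"
    using W_sub unfolding irred_hw_module_def by auto
  have invW: "graded_invariant ?L rho P W"
    and irrW: "\<And>U. U \<subseteq> W \<Longrightarrow> graded_invariant ?L rho P U \<Longrightarrow> U = {0} \<or> U = W"
    using W_sub unfolding irred_hw_module_def by auto
  have branch: "LamT i = Lam i \<or> LamT i = Lam i + 1" if "i \<in> {1..m}" for i
    by (rule branching_weights[OF rep N V_irr w(2-5) that])
  have diag: "psign (par m p + par m p * par m p) = 1" for p by (simp add: psign_def par_def)
  \<comment> \<open>Stated for every s with a conditional, so that the nonzero scalars and the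
    vanishing ones come from one formula.\<close>
  have unbarred: "Qproj m n LamT rho s N N *v x = (if s \<in> Itil m n Lam LamT then
      (\<Prod>k\<in>Itil m n Lam LamT - {s}. 1 / (beta m n LamT s - beta m n LamT k)) *
      (\<Prod>r\<in>Iset m n Lam LamT. beta m n LamT s - alpha m n Lam r - psign (par m r)) else 0) *s x"
    if s: "s \<in> {1..N}" and x: "x \<in> W" for s x
    unfolding Qproj_def Itil_def N_def[symmetric]
  proof (rule corner_projection_eigenvalue[OF rep N irrV invW irrW _ v(1) _ v(2) w(1,2) _ w(4) _ _ gen_beta _ _ s x,
        where rk = int])
    show "beta m n LamT p = of_real (eps m p) * LamT p + (\<Sum>t\<in>{t\<in>{1..N}. int p < int t}. of_real (eps m t))"
      if "p \<in> {1..N}" for p using beta_eq[of p m n LamT] that unfolding N_def .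
    show "alpha m n Lam p = of_real (eps m p) * Lam p + (\<Sum>t\<in>{t\<in>{1..?L}. int p < int t}. of_real (eps m t))"
      if "p \<in> {1..?L}" for p by (rule alpha_eq[OF that])
    show "alpha m n Lam i = beta m n LamT i \<or> alpha m n Lam i = beta m n LamT i + 1" if "i \<in> {1..m}" for i
      using branch[OF that] that by (auto simp: alpha_def beta_def)
    show "Iset m n Lam LamT = {i\<in>{1..m}. alpha m n Lam i = beta m n LamT i} \<union> {m+1..?L}"
      by (simp add: Iset_def I0_def I1_def)
  qed (use v(3) w(5) in \<open>auto simp: inj_on_def\<close>)
  \<comment> \<open>For the dual representation v and w are singular in the reversed order, with
    negated weights.\<close>
  have barred: "Qbarproj m n LamT rho s N N *v x = (if s \<in> Itilprime m n Lam LamT then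
      (\<Prod>k\<in>Itilprime m n Lam LamT - {s}. 1 / (betabar m n LamT s - betabar m n LamT k)) *
      (\<Prod>r\<in>Iprime m n Lam LamT. betabar m n LamT s - alphabar m n Lam r - psign (par m r)) else 0) *s x"
    if s: "s \<in> {1..N}" and x: "x \<in> W" for s x
    unfolding Qbarproj_def Bbarmat_eq Itilprime_def N_def[symmetric]
  proof (rule corner_projection_eigenvalue[OF drep N _ _ _ _ v(1) _ _ w(1,2) _ _ _ _ gen_betabar _ _ s x,
        where rk = "\<lambda>p. - int p" and lamT = "\<lambda>p. - LamT p" and lam = "\<lambda>p. - Lam p"])
    show "U = {0} \<or> U = UNIV" if "graded_invariant N ?d P U" for U
      using irrV that by (simp only: graded_invariant_dual)
    show "graded_invariant ?L ?d P W" using invW by (simp only: graded_invariant_dual)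
    show "U = {0} \<or> U = W" if "U \<subseteq> W" "graded_invariant ?L ?d P U" for U
      using irrW that by (simp only: graded_invariant_dual)
    show "?d p q *v v = 0" if "p \<in> {1..N}" "q \<in> {1..N}" "- int p < - int q" for p q
      using v(3)[of q p] that by (simp add: dual_rho_apply)
    show "?d p p *v v = (- LamT p) *s v" if "p \<in> {1..N}" for p
      using v(2)[OF that] by (simp add: dual_rho_apply diag)
    show "?d p q *v w = 0" if "p \<in> {1..?L}" "q \<in> {1..?L}" "- int p < - int q" for p q
      using w(5)[of q p] that by (simp add: dual_rho_apply)
    show "?d p p *v w = (- Lam p) *s w" if "p \<in> {1..?L}" for p
      using w(4)[OF that] by (simp add: dual_rho_apply diag)
    show "betabar m n LamT p = of_real (eps m p) * (- LamT p)
        + (\<Sum>t\<in>{t\<in>{1..N}. - int p < - int t}. of_real (eps m t))" if "p \<in> {1..N}" for p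
      unfolding betabar_def by (rule bar_root_eq[OF that])
    show "alphabar m n Lam p = of_real (eps m p) * (- Lam p)
        + (\<Sum>t\<in>{t\<in>{1..?L}. - int p < - int t}. of_real (eps m t))" if "p \<in> {1..?L}" for p
      unfolding alphabar_def by (rule bar_root_eq[OF that])
    show "alphabar m n Lam i = betabar m n LamT i \<or> alphabar m n Lam i = betabar m n LamT i + 1"
      if "i \<in> {1..m}" for i
      using branch[OF that] that by (auto simp: alphabar_def betabar_def)
    \<comment> \<open>The bar exchanges the two branching cases: both \<alpha>_i = \<beta>_i + 1 and
      equality of the barred roots say that the weights at i agree.\<close>
    show "Iprime m n Lam LamT = {i\<in>{1..m}. alphabar m n Lam i = betabar m n LamT i} \<union> {m+1..?L}"
      by (auto simp: Iprime_def I0bar_def I1_def alpha_def beta_def alphabar_def betabar_def)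
  qed (auto simp: inj_on_def)
  have comm: "Qproj m n LamT rho r N N ** rho p q = rho p q ** Qproj m n LamT rho r N N"
    if "p \<in> {1..?L}" "q \<in> {1..?L}" for r p q
    using opmat_poly_corner_commute(1)[OF rep N(1) that]
    unfolding Qproj_def N_def[symmetric] by (intro mat_endo_inj) (simp add: mat_endo_mult)
  have bar_comm: "Qbarproj m n LamT rho r N N ** rho p q = rho p q ** Qbarproj m n LamT rho r N N"
    if pq: "p \<in> {1..?L}" "q \<in> {1..?L}" for r p q
  proof (rule mat_endo_inj)
    let ?c = "mat_endo (Qbarproj m n LamT rho r N N)"
      and ?a = "mat_endo (mat (- psign (par m q + par m q * par m p)))"
    have c1: "?c * mat_endo (?d q p) = mat_endo (?d q p) * ?c"
      unfolding Qbarproj_def Bbarmat_eq N_def[symmetric]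
      by (rule opmat_poly_corner_commute(1)[OF drep N(1) pq(2,1)])
    have c2: "?c * ?a = ?a * ?c"
      unfolding Qbarproj_def Bbarmat_eq N_def[symmetric]
      by (rule opmat_poly_corner_commute(3)[OF drep N(1)])
    have "?c * (?a * mat_endo (?d q p)) = (?c * ?a) * mat_endo (?d q p)" by (simp only: mult.assoc)
    also have "\<dots> = ?a * (?c * mat_endo (?d q p))" unfolding c2 by (simp only: mult.assoc)
    also have "\<dots> = (?a * mat_endo (?d q p)) * ?c" unfolding c1 by (simp only: mult.assoc)
    finally have "?c * (?a * mat_endo (?d q p)) = (?a * mat_endo (?d q p)) * ?c" .
    then show "mat_endo (Qbarproj m n LamT rho r N N ** rho p q) = mat_endo (rho p q ** Qbarproj m n LamT rho r N N)"
      unfolding mat_endo_mult rho_eq_dual_rho[of rho p q m] .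
  qed
  \<comment> \<open>The vanishing claims are instances of the conditional formulas because the two
    branching cases exclude each other.\<close>
  have sub: "Itil m n Lam LamT \<subseteq> {1..N}" "Itilprime m n Lam LamT \<subseteq> {1..N}"
    "I0bar m n Lam LamT \<subseteq> {1..N} - Itil m n Lam LamT" "I0 m n Lam LamT \<subseteq> {1..N} - Itilprime m n Lam LamT"
    by (auto simp: Itil_def Iset_def Itilprime_def Iprime_def I0_def I0bar_def I1_def N_def)
  show ?thesis
    using comm bar_comm sub by (auto simp: unbarred barred subset_iff)
qed

end
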